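(* Let $G$ be a finite group. Let $\mathscr{C}_G$ be the set of all cyclic subgroups of $G$, partially ordered by inclusion, let $\overline{\mathscr{C}_G}=\mathscr{C}_G\cup\{\infty\}$, where $\infty$ is an abstract element with $C<\infty$ for every $C\in\mathscr{C}_G$, and let $\mu\colon\overline{\mathscr{C}_G}\times\overline{\mathscr{C}_G}\to\mathbb{Z}$ be the Möbius function of the finite partially ordered set $\overline{\mathscr{C}_G}$. Then for any Galois cover $Y/X$ of finite connected graphs with $\operatorname{Gal}(Y/X)=G$, we have $$\kappa(X)=\prod_{C\in\mathscr{C}_G}\bigl([G:C]\cdot\kappa(X_C)\bigr)^{-\frac{1}{[G:C]}\mu(C,\infty)},$$ where $X_C$ denotes the intermediate graph of $Y/X$ corresponding to $C$ (the rational powers being positive real powers of positive integers).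
   Context: Graphs (in the sense of Serre): a graph $X=(V_X,E_X,o,t,\iota)$ consists of sets $V_X$ (vertices), $E_X$ (oriented edges) and maps $o,t\colon E_X\to V_X$, $\iota\colon E_X\to E_X$ with $\iota(\iota(e))=e$, $\iota(e)\neq e$, $o(\iota(e))=t(e)$, $t(\iota(e))=o(e)$ for all $e\in E_X$. Write $\bar e=\iota(e)$. Loops and multiple edges are allowed; each pair $\{e,\bar e\}$ is one undirected edge. The complexity $\kappa(X)$ of a finite connected graph $X$ is its number of spanning trees. A morphism $f\colon Y\to X$ is a pair of maps $V_Y\to V_X$, $E_Y\to E_X$ (both written $f$) commuting with $o$, $t$, $\iota$; it is an isomorphism if both maps are bijective. A covering map (cover) $\pi\colon Y\to X$ is a morphism that is surjective on vertices and such that for each $w\in V_Y$ it restricts to a bijection $\{e\in E_Y\mid o(e)=w\}\to\{e\in E_X\mid o(e)=\pi(w)\}$. $\operatorname{Aut}(Y/X)$ is the group of isomorphisms $\sigma\colon Y\to Y$ with $\pi\circ\sigma=\pi$. A cover $\pi\colon Y\to X$ is a Galois cover if $Y$ is connected and $\operatorname{Aut}(Y/X)$ acts transitively on each fiber $\pi^{-1}(v)$, $v\in V_X$; then one writes $\operatorname{Gal}(Y/X)=\operatorname{Aut}(Y/X)$. For a subgroup $H\le\operatorname{Gal}(Y/X)$, the intermediate graph $X_H$ corresponding to $H$ (under the Galois correspondence between subgroups and equivalence classes of intermediate covers $Y\to X_H\to X$) is the quotient graph of $Y$ by $H$; so $X_{\{1\}}=Y$ and $X_G=X$. The Möbius function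 of a finite partially ordered set $\mathscr{L}$ is the function $\mu\colon\mathscr{L}\times\mathscr{L}\to\mathbb{Z}$ with $\mu(x,x)=1$, $\mu(x,y)=-\sum_{z\in\mathscr{L},\,x\le z<y}\mu(x,z)$ if $x<y$, and $\mu(x,y)=0$ otherwise. *)

theory Defs
  imports
    Complex_Main
    "HOL-Library.Extended"
    "HOL-Algebra.Elementary_Groups"
    "Graph_Theory.Graph_Theory"
begin

text \<open>
  A graph in the sense of Serre is a digraph \<open>X\<close> together with a map \<open>i\<close> such that
  \<^term>\<open>bidirected_digraph X i\<close>; the arcs are the oriented edges, \<open>tail\<close> and \<open>head\<close> are
  the origin and the terminus, and \<open>i\<close> is the fixed-point free inversion of the arcs
  (by the convention of that locale \<open>i\<close> is the identity outside the arcs).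
\<close>

section \<open>Complexity\<close>

text \<open>
  The library predicates \<^const>\<open>forest\<close> and \<^const>\<open>spanning_tree\<close> refer to directed cycles, for
  which \<open>[e, i e]\<close> is a cycle.  The trees below are trees in the undirected sense: subgraphs
  are closed under inversion, and a circuit is a cycle that does not use an edge in both
  directions.  So loops and pairs of parallel edges are circuits.
\<close>

definition circuit :: "('v, 'e) pre_digraph \<Rightarrow> ('e \<Rightarrow> 'e) \<Rightarrow> 'e list \<Rightarrow> bool" where
  "circuit X i p \<longleftrightarrow> pre_digraph.cycle X p \<and> (\<forall>e\<in>set p. i e \<notin> set p)"

definition spanning_trees ::
    "('v, 'e) pre_digraph \<Rightarrow> ('e \<Rightarrow> 'e) \<Rightarrow> ('v, 'e) pre_digraph set" where
  "spanning_trees X i =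
    {T. spanning T X \<and> i ` arcs T \<subseteq> arcs T \<and> connected T \<and> \<not> (\<exists>p. circuit T i p)}"

definition complexity :: "('v, 'e) pre_digraph \<Rightarrow> ('e \<Rightarrow> 'e) \<Rightarrow> nat" where
  "complexity X i = card (spanning_trees X i)"

section \<open>Covers and their automorphism groups\<close>

text \<open>A morphism is the pair of its vertex map and its edge map.\<close>

type_synonym ('v, 'e, 'w, 'f) graph_map = "('v \<Rightarrow> 'w) \<times> ('e \<Rightarrow> 'f)"

definition graph_morphism :: "('v, 'e) pre_digraph \<Rightarrow> ('e \<Rightarrow> 'e) \<Rightarrow>
    ('w, 'f) pre_digraph \<Rightarrow> ('f \<Rightarrow> 'f) \<Rightarrow> ('v, 'e, 'w, 'f) graph_map \<Rightarrow> bool" where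
  "graph_morphism Y j X i f \<longleftrightarrow>
    fst f ` verts Y \<subseteq> verts X \<and> snd f ` arcs Y \<subseteq> arcs X \<and>
    (\<forall>e\<in>arcs Y. tail X (snd f e) = fst f (tail Y e) \<and>
                head X (snd f e) = fst f (head Y e) \<and>
                i (snd f e) = snd f (j e))"

definition graph_isomorphism :: "('v, 'e) pre_digraph \<Rightarrow> ('e \<Rightarrow> 'e) \<Rightarrow>
    ('w, 'f) pre_digraph \<Rightarrow> ('f \<Rightarrow> 'f) \<Rightarrow> ('v, 'e, 'w, 'f) graph_map \<Rightarrow> bool" where
  "graph_isomorphism Y j X i f \<longleftrightarrow> graph_morphism Y j X i f \<and>
    bij_betw (fst f) (verts Y) (verts X) \<and> bij_betw (snd f) (arcs Y) (arcs X)"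

definition covering_map :: "('v, 'e) pre_digraph \<Rightarrow> ('e \<Rightarrow> 'e) \<Rightarrow>
    ('w, 'f) pre_digraph \<Rightarrow> ('f \<Rightarrow> 'f) \<Rightarrow> ('v, 'e, 'w, 'f) graph_map \<Rightarrow> bool" where
  "covering_map Y j X i \<pi> \<longleftrightarrow> graph_morphism Y j X i \<pi> \<and>
    fst \<pi> ` verts Y = verts X \<and>
    (\<forall>w\<in>verts Y. bij_betw (snd \<pi>) (out_arcs Y w) (out_arcs X (fst \<pi> w)))"

text \<open>
  The group \<open>Aut(Y/X)\<close>.  Automorphisms are total functions here; requiring them to be the
  identity outside \<open>Y\<close> makes every automorphism occur exactly once.
\<close>

definition cover_automorphisms :: "('v, 'e) pre_digraph \<Rightarrow> ('e \<Rightarrow> 'e) \<Rightarrow>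
    ('v, 'e, 'w, 'f) graph_map \<Rightarrow> ('v, 'e, 'v, 'e) graph_map set" where
  "cover_automorphisms Y j \<pi> = {\<sigma>. graph_isomorphism Y j Y j \<sigma> \<and>
    (\<forall>w\<in>verts Y. fst \<pi> (fst \<sigma> w) = fst \<pi> w) \<and> (\<forall>e\<in>arcs Y. snd \<pi> (snd \<sigma> e) = snd \<pi> e) \<and>
    (\<forall>w. w \<notin> verts Y \<longrightarrow> fst \<sigma> w = w) \<and> (\<forall>e. e \<notin> arcs Y \<longrightarrow> snd \<sigma> e = e)}"

definition cover_group :: "('v, 'e) pre_digraph \<Rightarrow> ('e \<Rightarrow> 'e) \<Rightarrow>
    ('v, 'e, 'w, 'f) graph_map \<Rightarrow> ('v, 'e, 'v, 'e) graph_map monoid" where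
  "cover_group Y j \<pi> = \<lparr>carrier = cover_automorphisms Y j \<pi>,
    monoid.mult = (\<lambda>\<sigma> \<tau>. (fst \<sigma> \<circ> fst \<tau>, snd \<sigma> \<circ> snd \<tau>)), one = (id, id)\<rparr>"

definition galois_cover :: "('v, 'e) pre_digraph \<Rightarrow> ('e \<Rightarrow> 'e) \<Rightarrow>
    ('w, 'f) pre_digraph \<Rightarrow> ('f \<Rightarrow> 'f) \<Rightarrow> ('v, 'e, 'w, 'f) graph_map \<Rightarrow> bool" where
  "galois_cover Y j X i \<pi> \<longleftrightarrow> covering_map Y j X i \<pi> \<and> connected Y \<and>
    (\<forall>v\<in>verts X. \<forall>w\<in>verts Y. \<forall>w'\<in>verts Y. fst \<pi> w = v \<and> fst \<pi> w' = v \<longrightarrow>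
      (\<exists>\<sigma>\<in>carrier (cover_group Y j \<pi>). fst \<sigma> w = w'))"

section \<open>Intermediate graphs\<close>

text \<open>
  The quotient graph of \<open>Y\<close> by a group \<open>H\<close> of automorphisms: its vertices and arcs are the orbits.
  The tails of the arcs in the orbit of \<open>e\<close> form the orbit of the tail of \<open>e\<close>, so taking images
  of orbits induces the tail, head and inversion maps on orbits.
\<close>

definition vert_orbit :: "('v, 'e, 'v, 'e) graph_map set \<Rightarrow> 'v \<Rightarrow> 'v set" where
  "vert_orbit H w = (\<lambda>\<sigma>. fst \<sigma> w) ` H"

definition arc_orbit :: "('v, 'e, 'v, 'e) graph_map set \<Rightarrow> 'e \<Rightarrow> 'e set" where
  "arc_orbit H e = (\<lambda>\<sigma>. snd \<sigma> e) ` H"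

definition quotient_graph :: "('v, 'e) pre_digraph \<Rightarrow> ('v, 'e, 'v, 'e) graph_map set \<Rightarrow>
    ('v set, 'e set) pre_digraph" where
  "quotient_graph Y H = \<lparr>verts = vert_orbit H ` verts Y, arcs = arc_orbit H ` arcs Y,
    tail = (\<lambda>E. tail Y ` E), head = (\<lambda>E. head Y ` E)\<rparr>"

definition quotient_inversion :: "('v, 'e) pre_digraph \<Rightarrow> ('e \<Rightarrow> 'e) \<Rightarrow>
    ('v, 'e, 'v, 'e) graph_map set \<Rightarrow> 'e set \<Rightarrow> 'e set" where
  "quotient_inversion Y j H E = (if E \<in> arcs (quotient_graph Y H) then j ` E else E)"

section \<open>The poset of cyclic subgroups and its Moebius function\<close>

definition cyclic_subgroups :: "('g, 'm) monoid_scheme \<Rightarrow> 'g set set" where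
  "cyclic_subgroups G = {C. subgroup C G \<and> cyclic_group (G\<lparr>carrier := C\<rparr>)}"

text \<open>The adjoined top element is \<^const>\<open>Pinf\<close>, and \<^const>\<open>Fin\<close> embeds the subgroups.\<close>

definition cyclic_subgroups_top :: "('g, 'm) monoid_scheme \<Rightarrow> 'g set extended set" where
  "cyclic_subgroups_top G = insert Pinf (Fin ` cyclic_subgroups G)"

text \<open>
  The Moebius function of the finite poset \<open>L\<close>, ordered by the restriction of the order of its type.
  Finiteness of \<open>L\<close> ensures termination; the value is \<open>0\<close> for infinite \<open>L\<close> and outside \<open>L\<close>.
\<close>

function moebius :: "'a::order set \<Rightarrow> 'a \<Rightarrow> 'a \<Rightarrow> int" where
  "moebius L x y =
    (if finite L \<and> x \<in> L \<and> y \<in> L then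
       if x = y then 1
       else if x < y then - (\<Sum>z\<in>{z\<in>L. x \<le> z \<and> z < y}. moebius L x z)
       else 0
     else 0)"
  by auto
termination
proof (relation "measure (\<lambda>(L, x, y). card {z\<in>L. z < y})", goal_cases)
  case (2 L x y z)
  then have "{u\<in>L. u < z} \<subset> {u\<in>L. u < y}"
    by auto
  with 2 show ?case
    by (auto intro: psubset_card_mono)
qed simp

declare moebius.simps [simp del]

end

theory Submission
  imports "Jordan_Normal_Form.Schur_Decomposition" Defs
begin

text \<open>
  Let \<open>F_X x = det (x I + L_X)\<close> for the Laplacian \<open>L_X\<close> of a graph \<open>X\<close>.  Expanding the determinant
  over the choices of one outgoing arc or none at every vertex shows that \<open>F_X x\<close> is the sum of
  \<open>x\<close> to the number of roots over the rooted spanning forests of \<open>X\<close>, hence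
  \<open>F_X x / x\<close> tends to \<open>|X| * \<kappa>(X)\<close> as \<open>x\<close> tends to \<open>0\<close>.  As \<open>C\<close> acts freely on \<open>Y\<close>, the trace of a
  power of \<open>L_(X_C)\<close> is the average over \<open>g \<in> C\<close> of the traces of \<open>g\<close> times that power of \<open>L_Y\<close>.
  Moebius inversion writes the sum over \<open>G\<close> as the combination of the sums over the cyclic subgroups
  \<open>C\<close> with coefficients \<open>- \<mu>(C, \<infinity>)\<close>.  So the power traces of \<open>L_X\<close> are the combination of those of
  \<open>L_(X_C)\<close> with coefficients \<open>- \<mu>(C, \<infinity>) / [G : C]\<close>.  The same relation then holds for every
  function of the eigenvalues, in particular for \<open>ln (F_X x)\<close>, and the limit \<open>x \<rightarrow> 0\<close> gives the claim.
\<close>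

section \<open>Power traces and characteristic polynomials\<close>

definition mat_trace :: "'a::comm_ring_1 mat \<Rightarrow> 'a" where
  "mat_trace A = (\<Sum>i<dim_row A. A $$ (i, i))"

lemma mat_trace_mult_commute:
  assumes "A \<in> carrier_mat n m" "B \<in> carrier_mat m n"
  shows "mat_trace (A * B) = mat_trace (B * A)"
proof -
  have "mat_trace (A * B) = (\<Sum>i<n. \<Sum>j<m. A $$ (i, j) * B $$ (j, i))"
    using assms by (auto simp: mat_trace_def scalar_prod_def atLeast0LessThan intro!: sum.cong)
  also have "\<dots> = (\<Sum>j<m. \<Sum>i<n. A $$ (i, j) * B $$ (j, i))"
    by (rule sum.swap)
  also have "\<dots> = mat_trace (B * A)"
    using assms
    by (auto simp: mat_trace_def scalar_prod_def atLeast0LessThan mult.commute intro!: sum.cong)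
  finally show ?thesis .
qed

text \<open>In the entry (i, j) with j <= i of a product of two upper triangular matrices, the l-th
  summand has a zero factor on the left if l < i and on the right if l > j. Only l = i = j
  survives.\<close>

lemma upper_triangular_pow:
  assumes B: "B \<in> carrier_mat n n" "upper_triangular (B :: 'a::comm_ring_1 mat)"
  shows "upper_triangular (B ^\<^sub>m k) \<and> (\<forall>i<n. (B ^\<^sub>m k) $$ (i, i) = (B $$ (i, i)) ^ k)"
proof (induction k)
  case 0
  then show ?case using B by (auto simp: upper_triangular_def)
next
  case (Suc k)
  have Bk: "B ^\<^sub>m k \<in> carrier_mat n n" using B by (simp add: pow_carrier_mat)
  have entry: "(B ^\<^sub>m Suc k) $$ (i, j) = (\<Sum>l<n. (B ^\<^sub>m k) $$ (i, l) * B $$ (l, j))"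
    if "i < n" "j < n" for i j
    using that B Bk by (auto simp: scalar_prod_def atLeast0LessThan intro!: sum.cong)
  have low: "(B ^\<^sub>m k) $$ (i, l) = 0" if "i < n" "l < i" for i l
    using Suc that Bk by (auto simp: upper_triangular_def)
  have lowB: "B $$ (i, l) = 0" if "i < n" "l < i" for i l
    using that B by (auto simp: upper_triangular_def)
  have "(B ^\<^sub>m Suc k) $$ (i, j) = 0" if "i < n" "j < i" for i j
  proof -
    have "(B ^\<^sub>m k) $$ (i, l) * B $$ (l, j) = 0" if "l < n" for l
      using low[of i l] lowB[of l j] that \<open>i < n\<close> \<open>j < i\<close> by (cases "l < i") auto
    then show ?thesis
      using that by (subst entry) (auto intro!: sum.neutral)
  qed
  moreover have "(B ^\<^sub>m Suc k) $$ (i, i) = (B $$ (i, i)) ^ Suc k" if "i < n" for i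
  proof -
    have "(B ^\<^sub>m k) $$ (i, l) * B $$ (l, i) = 0" if "l < n" "l \<noteq> i" for l
      using low[of i l] lowB[of l i] that \<open>i < n\<close> by (cases "l < i") auto
    then have "(\<Sum>l<n. (B ^\<^sub>m k) $$ (i, l) * B $$ (l, i)) =
        (\<Sum>l\<in>{i}. (B ^\<^sub>m k) $$ (i, l) * B $$ (l, i))"
      using that by (intro sum.mono_neutral_right) auto
    then show ?thesis
      using Suc that by (subst entry) (auto simp: mult.commute)
  qed
  ultimately show ?case
    using B Bk by (auto simp: upper_triangular_def)
qed

text \<open>Schur decomposition makes A similar to an upper triangular matrix whose diagonal is the
  list \<open>es\<close>, with multiplicities. Powers respect the similarity, and the cyclicity of
  the trace removes the conjugation.\<close>

lemma mat_trace_pow_eigenvalues: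
  assumes A: "A \<in> carrier_mat n n"
    and es: "char_poly A = (\<Prod>e\<leftarrow>es. [:- e, 1:])"
  shows "mat_trace (A ^\<^sub>m k) = (\<Sum>e\<leftarrow>es. (e::complex) ^ k)"
proof -
  obtain B P Q where "schur_decomposition A es = (B, P, Q)"
    by (cases "schur_decomposition A es") auto
  from schur_decomposition[OF A es this]
  have wit: "similar_mat_wit A B P Q" and tri: "upper_triangular B" and diag: "diag_mat B = es"
    by auto
  note sim = similar_mat_witD2[OF A wit]
  have Bk: "B ^\<^sub>m k \<in> carrier_mat n n" using sim by (simp add: pow_carrier_mat)
  have "mat_trace (A ^\<^sub>m k) = mat_trace ((P * B ^\<^sub>m k) * Q)"
    by (simp add: similar_mat_wit_pow_id[OF wit])
  also have "\<dots> = mat_trace (Q * (P * B ^\<^sub>m k))"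
    using sim Bk by (intro mat_trace_mult_commute[of _ n n]) auto
  also have "Q * (P * B ^\<^sub>m k) = (Q * P) * B ^\<^sub>m k"
    using sim Bk by (intro assoc_mult_mat[symmetric, of _ n n _ n _ n]) auto
  also have "\<dots> = B ^\<^sub>m k"
    using sim Bk by simp
  also have "mat_trace (B ^\<^sub>m k) = (\<Sum>i<n. (B $$ (i, i)) ^ k)"
    using upper_triangular_pow[of B n k] tri sim Bk by (auto simp: mat_trace_def)
  also have "\<dots> = (\<Sum>e\<leftarrow>diag_mat B. e ^ k)"
    using sim by (simp add: diag_mat_def comp_def interv_sum_list_conv_sum_set_nat
        atLeast0LessThan carrier_matD(1)[of B n n])
  finally show ?thesis by (simp add: diag)
qed

lemma exists_interpolating_poly:
  assumes "finite S"
  shows "\<exists>p. \<forall>s\<in>S. poly p s = (f s :: 'a::field)"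
  using assms
proof induction
  case (insert a S)
  then obtain p where p: "\<forall>s\<in>S. poly p s = f s" by auto
  \<comment> \<open>Newton interpolation: q vanishes at the old nodes, so a multiple of it corrects
    the value at the new node alone.\<close>
  define q where "q = (\<Prod>s\<in>S. [:- s, 1:])"
  have q: "poly q s = 0" if "s \<in> S" for s
    using that insert by (auto simp: q_def poly_prod)
  have qa: "poly q a \<noteq> 0"
    using insert by (auto simp: q_def poly_prod)
  have "\<forall>s\<in>insert a S. poly (p + smult ((f a - poly p a) / poly q a) q) s = f s"
    using p q qa by auto
  then show ?case by blast
qed auto

lemma det_eq_prod_eigenvalues:
  assumes A: "A \<in> carrier_mat n n"
    and es: "char_poly A = (\<Prod>e\<leftarrow>es. [:- e, 1:])"
  shows "det (x \<cdot>\<^sub>m 1\<^sub>m n - A) = (\<Prod>e\<leftarrow>es. x - (e::complex))"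
proof -
  have "x \<cdot>\<^sub>m 1\<^sub>m n - A = - char_matrix A x"
    using A by (intro eq_matI) (auto simp: char_matrix_def)
  then have "det (x \<cdot>\<^sub>m 1\<^sub>m n - A) = poly (char_poly A) x"
    by (simp add: char_poly_matrix[OF A])
  also have "\<dots> = (\<Prod>e\<leftarrow>es. x - e)"
    unfolding es by (induction es) (auto simp: algebra_simps)
  finally show ?thesis .
qed

text \<open>For the list of eigenvalues of a matrix the inner sums are its power traces, so the left
  side depends linearly on these traces.\<close>

lemma sum_list_poly:
  "(\<Sum>e\<leftarrow>es. poly p e) = (\<Sum>k\<le>degree p. coeff p k * (\<Sum>e\<leftarrow>es. (e::'a::comm_ring_1) ^ k))"
  by (induction es) (auto simp: poly_altdef sum.distrib algebra_simps)

text \<open>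
  Any function on the finitely many eigenvalues, in particular the logarithm of the distance
  to \<open>x\<close>, is a polynomial there, so relations between power traces carry over to
  logarithms of characteristic polynomials.
\<close>
lemma ln_det_relation:
  fixes M :: "'c \<Rightarrow> complex mat" and M0 :: "complex mat" and a :: "'c \<Rightarrow> real"
  assumes fin: "finite I"
    and M: "\<And>C. C \<in> I \<Longrightarrow> M C \<in> carrier_mat (d C) (d C)" and M0: "M0 \<in> carrier_mat n n"
    and tr: "\<And>k. mat_trace (M0 ^\<^sub>m k) = (\<Sum>C\<in>I. of_real (a C) * mat_trace (M C ^\<^sub>m k))"
    and nz: "\<And>C. C \<in> I \<Longrightarrow> det (x \<cdot>\<^sub>m 1\<^sub>m (d C) - M C) \<noteq> 0"
    and nz0: "det (x \<cdot>\<^sub>m 1\<^sub>m n - M0) \<noteq> 0"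
  shows "ln (cmod (det (x \<cdot>\<^sub>m 1\<^sub>m n - M0))) =
    (\<Sum>C\<in>I. a C * ln (cmod (det (x \<cdot>\<^sub>m 1\<^sub>m (d C) - M C))))"
proof -
  have "\<exists>es. char_poly (M C) = (\<Prod>e\<leftarrow>es. [:- e, 1:])" if "C \<in> I" for C
    using char_poly_factorized[OF M[OF that]] by auto
  then obtain es where es: "\<And>C. C \<in> I \<Longrightarrow> char_poly (M C) = (\<Prod>e\<leftarrow>es C. [:- e, 1:])"
    by metis
  obtain fs where fs: "char_poly M0 = (\<Prod>e\<leftarrow>fs. [:- e, 1:])"
    using char_poly_factorized[OF M0] by auto
  \<comment> \<open>S holds the eigenvalues of all the matrices, so one polynomial p, with the same
    coefficients everywhere, serves both sides of the relation.\<close>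
  define S where "S = set fs \<union> (\<Union>C\<in>I. set (es C))"
  have "finite S" using fin by (auto simp: S_def)
  then obtain p where p: "\<And>e. e \<in> S \<Longrightarrow> poly p e = of_real (ln (cmod (x - e)))"
    using exists_interpolating_poly[of S "\<lambda>e. of_real (ln (cmod (x - e)))"] by auto
  \<comment> \<open>A nonzero product has nonzero factors, which is what lets \<open>ln\<close> turn
    it into a sum.\<close>
  have ln_prod: "of_real (ln (cmod (\<Prod>e\<leftarrow>l. x - e))) = (\<Sum>e\<leftarrow>l. poly p e)"
    if "set l \<subseteq> S" "(\<Prod>e\<leftarrow>l. x - e) \<noteq> 0" for l
    using that
  proof (induction l)
    case (Cons e l)
    then have "cmod (x - e) > 0" "cmod (\<Prod>e\<leftarrow>l. x - e) > 0" by auto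
    then have "ln (cmod (\<Prod>e\<leftarrow>e # l. x - e)) = ln (cmod (x - e)) + ln (cmod (\<Prod>e\<leftarrow>l. x - e))"
      by (simp add: norm_mult ln_mult)
    with Cons p[of e] show ?case by simp
  qed simp
  have ln_det: "of_real (ln (cmod (det (x \<cdot>\<^sub>m 1\<^sub>m m - A)))) =
      (\<Sum>k\<le>degree p. coeff p k * mat_trace (A ^\<^sub>m k))"
    if A: "A \<in> carrier_mat m m" "char_poly A = (\<Prod>e\<leftarrow>l. [:- e, 1:])" "set l \<subseteq> S"
      "det (x \<cdot>\<^sub>m 1\<^sub>m m - A) \<noteq> 0" for A m l
  proof -
    have "of_real (ln (cmod (det (x \<cdot>\<^sub>m 1\<^sub>m m - A)))) = (\<Sum>e\<leftarrow>l. poly p e)"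
      using ln_prod[of l] A by (simp add: det_eq_prod_eigenvalues[OF A(1,2)])
    also have "\<dots> = (\<Sum>k\<le>degree p. coeff p k * mat_trace (A ^\<^sub>m k))"
      by (simp add: sum_list_poly mat_trace_pow_eigenvalues[OF A(1,2)])
    finally show ?thesis .
  qed
  have "(of_real (ln (cmod (det (x \<cdot>\<^sub>m 1\<^sub>m n - M0)))) :: complex) =
      (\<Sum>k\<le>degree p. coeff p k * mat_trace (M0 ^\<^sub>m k))"
    by (rule ln_det[OF M0 fs _ nz0]) (auto simp: S_def)
  also have "\<dots> = (\<Sum>k\<le>degree p. \<Sum>C\<in>I. of_real (a C) * (coeff p k * mat_trace (M C ^\<^sub>m k)))"
    by (auto simp: tr sum_distrib_left mult_ac intro!: sum.cong)
  also have "\<dots> = (\<Sum>C\<in>I. of_real (a C) * (\<Sum>k\<le>degree p. coeff p k * mat_trace (M C ^\<^sub>m k)))"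
    by (subst sum.swap) (simp add: sum_distrib_left)
  also have "\<dots> = (\<Sum>C\<in>I. of_real (a C) * of_real (ln (cmod (det (x \<cdot>\<^sub>m 1\<^sub>m (d C) - M C)))))"
    by (intro sum.cong refl arg_cong2[where f = "(*)"] ln_det[symmetric, OF M es _ nz])
       (auto simp: S_def)
  also have "\<dots> = of_real (\<Sum>C\<in>I. a C * ln (cmod (det (x \<cdot>\<^sub>m 1\<^sub>m (d C) - M C))))"
    by simp
  finally show ?thesis by (simp only: of_real_eq_iff)
qed

section \<open>Expansion of the Laplacian over rooted forests\<close>

text \<open>Adjacency minus degree; the sign is chosen so that x I + L is x I minus this matrix, as
  in a characteristic polynomial. Parallel arcs count separately, and a loop contributes 1 - 1 =
  0.\<close>

definition neg_laplacian :: "('v, 'e) pre_digraph \<Rightarrow> 'v \<Rightarrow> 'v \<Rightarrow> 'a::comm_ring_1" where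
  "neg_laplacian X v w = (\<Sum>e\<in>out_arcs X v. of_bool (head X e = w) - of_bool (v = w))"

text \<open>Matrices are indexed by numbers, so \<open>b\<close> enumerates the vertices.\<close>

definition vertex_mat :: "nat \<Rightarrow> (nat \<Rightarrow> 'v) \<Rightarrow> ('v \<Rightarrow> 'v \<Rightarrow> 'a) \<Rightarrow> 'a mat" where
  "vertex_mat n b L = mat n n (\<lambda>(r, s). L (b r) (b s))"

lemma vertex_mat_carrier [simp]: "vertex_mat n b L \<in> carrier_mat n n"
  by (simp add: vertex_mat_def)

text \<open>Spanning forests are oriented towards their roots: \<^const>\<open>None\<close> marks a root.\<close>

definition exits :: "('v, 'e) pre_digraph \<Rightarrow> ('v \<Rightarrow> 'e option) set" where
  "exits X = (\<Pi>\<^sub>E v\<in>verts X. insert None (Some ` out_arcs X v))"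

definition exit_rel :: "('v, 'e) pre_digraph \<Rightarrow> ('v \<Rightarrow> 'e option) \<Rightarrow> ('v \<times> 'v) set" where
  "exit_rel X c = {(v, head X e) |v e. v \<in> verts X \<and> c v = Some e}"

definition exit_roots :: "('v, 'e) pre_digraph \<Rightarrow> ('v \<Rightarrow> 'e option) \<Rightarrow> 'v set" where
  "exit_roots X c = {v \<in> verts X. c v = None}"

definition rooted_forests :: "('v, 'e) pre_digraph \<Rightarrow> ('v \<Rightarrow> 'e option) set" where
  "rooted_forests X = {c \<in> exits X. acyclic (exit_rel X c)}"

text \<open>The part of row v of x I + L that belongs to one choice at v: x times a unit vector for
  a root, a difference of two unit vectors for an exit.\<close>

definition exit_row :: "('v, 'e) pre_digraph \<Rightarrow> 'a::comm_ring_1 \<Rightarrow> 'e option \<Rightarrow> 'v \<Rightarrow> 'v \<Rightarrow> 'a" where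
  "exit_row X x a v w = (case a of None \<Rightarrow> x * of_bool (v = w)
     | Some e \<Rightarrow> of_bool (v = w) - of_bool (head X e = w))"

lemma sum_exit_row:
  assumes "finite (out_arcs X v)"
  shows "(\<Sum>a\<in>insert None (Some ` out_arcs X v). exit_row X x a v w) =
    x * of_bool (v = w) - neg_laplacian X v w"
  using assms
  by (subst sum.insert)
     (auto simp: exit_row_def neg_laplacian_def sum.reindex sum_subtractf)

text \<open>Multilinearity in the rows: in the Leibniz formula the product over v of the sums over
  \<open>S v\<close> distributes into a sum over choice functions.\<close>

lemma det_sum_rows:
  fixes f :: "'v \<Rightarrow> 'k \<Rightarrow> 'v \<Rightarrow> 'a::comm_ring_1"
  assumes b: "bij_betw b {0..<n} V" and fin: "\<And>v. v \<in> V \<Longrightarrow> finite (S v)"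
  shows "det (vertex_mat n b (\<lambda>v w. \<Sum>a\<in>S v. f v a w)) =
    (\<Sum>c\<in>Pi\<^sub>E V S. det (vertex_mat n b (\<lambda>v. f v (c v))))"
proof -
  let ?P = "{p. p permutes {0..<n}}"
  \<comment> \<open>The inverse enumeration turns products over row indices into products over
    vertices, the form in which \<open>prod_sum_PiE\<close> applies.\<close>
  define b' where "b' = inv_into {0..<n} b"
  have b': "b' (b r) = r" if "r < n" for r
    using b that by (auto simp: b'_def bij_betw_def)
  have finV: "finite V" using b bij_betw_finite by blast
  have reindex: "(\<Prod>r = 0..<n. g (b r) r) = (\<Prod>v\<in>V. g v (b' v))" for g :: "'v \<Rightarrow> nat \<Rightarrow> 'a"
    by (subst prod.reindex_bij_betw[OF b, symmetric]) (auto simp: b')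
  have perm: "(\<Prod>i = 0..<n. vertex_mat n b L $$ (i, p i)) = (\<Prod>v\<in>V. L v (b (p (b' v))))"
    if "p permutes {0..<n}" for p and L :: "'v \<Rightarrow> 'v \<Rightarrow> 'a"
  proof -
    have "(\<Prod>i = 0..<n. vertex_mat n b L $$ (i, p i)) = (\<Prod>i = 0..<n. L (b i) (b (p i)))"
      using that permutes_in_image[OF that] by (intro prod.cong) (auto simp: vertex_mat_def)
    then show ?thesis using reindex[of "\<lambda>v r. L v (b (p r))"] by simp
  qed
  have "det (vertex_mat n b (\<lambda>v w. \<Sum>a\<in>S v. f v a w)) =
      (\<Sum>p\<in>?P. signof p * (\<Prod>v\<in>V. \<Sum>a\<in>S v. f v a (b (p (b' v)))))"
    by (simp add: det_def'[OF vertex_mat_carrier] perm)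
  also have "\<dots> = (\<Sum>p\<in>?P. signof p * (\<Sum>c\<in>Pi\<^sub>E V S. \<Prod>v\<in>V. f v (c v) (b (p (b' v)))))"
    using finV fin by (subst prod_sum_PiE) auto
  also have "\<dots> = (\<Sum>c\<in>Pi\<^sub>E V S. \<Sum>p\<in>?P. signof p * (\<Prod>v\<in>V. f v (c v) (b (p (b' v)))))"
    by (simp add: sum_distrib_left sum.swap[of _ "Pi\<^sub>E V S"])
  also have "\<dots> = (\<Sum>c\<in>Pi\<^sub>E V S. det (vertex_mat n b (\<lambda>v. f v (c v))))"
    by (simp add: det_def'[OF vertex_mat_carrier] perm)
  finally show ?thesis .
qed

section \<open>Determinants belonging to a single choice of exits\<close>

lemma finite_exit_rel: "finite (verts X) \<Longrightarrow> finite (exit_rel X c)"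
  by (rule finite_subset[of _ "(\<lambda>v. (v, head X (the (c v)))) ` verts X"])
     (auto simp: exit_rel_def image_iff)

text \<open>Off the diagonal, nonzero entries occur only along exits, so without a cycle of exits
  only the identity permutation contributes. Its diagonal entries are x at the roots and 1
  elsewhere.\<close>

lemma det_exit_row_acyclic:
  fixes x :: "'a::comm_ring_1"
  assumes b: "bij_betw b {0..<n} (verts X)" and ac: "acyclic (exit_rel X c)"
  shows "det (vertex_mat n b (\<lambda>v. exit_row X x (c v) v)) = x ^ card (exit_roots X c)"
proof -
  let ?M = "vertex_mat n b (\<lambda>v. exit_row X x (c v) v)"
  have finV: "finite (verts X)" using b bij_betw_finite by blast
  have wf: "wf ((exit_rel X c)\<inverse>)"
    using ac finV by (intro finite_acyclic_wf_converse finite_exit_rel)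
  have bV: "b r \<in> verts X" if "r < n" for r
    using b that by (auto simp: bij_betw_def)
  have binj: "b r = b s \<longleftrightarrow> r = s" if "r < n" "s < n" for r s
    using b that by (auto simp: bij_betw_def inj_on_def)
  \<comment> \<open>The points moved by a contributing permutation would be closed under \<^term>\<open>exit_rel X c\<close>.\<close>
  have zero: "(\<Prod>i = 0..<n. ?M $$ (i, p i)) = 0" if p: "p permutes {0..<n}" "p \<noteq> id" for p
  proof (rule ccontr)
    assume "(\<Prod>i = 0..<n. ?M $$ (i, p i)) \<noteq> 0"
    then have nz: "?M $$ (i, p i) \<noteq> 0" if "i < n" for i
      using that by (meson atLeastLessThan_iff finite_atLeastLessThan le0 prod_zero)
    have pn: "p i < n" if "i < n" for i
      using permutes_in_image[OF p(1), of i] that by simp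
    have step: "(b i, b (p i)) \<in> exit_rel X c" if "i < n" "p i \<noteq> i" for i
    proof -
      from nz[OF that(1)] have "exit_row X x (c (b i)) (b i) (b (p i)) \<noteq> 0"
        using that pn by (simp add: vertex_mat_def)
      then show ?thesis
        using that pn[OF that(1)] binj[of i "p i"] bV[of i]
        by (auto simp: exit_row_def exit_rel_def split: option.splits)
    qed
    define S where "S = b ` {i. i < n \<and> p i \<noteq> i}"
    obtain i where "p i \<noteq> i" using p(2) by (auto simp: fun_eq_iff)
    moreover from this have "i < n"
      using p(1) by (auto simp: permutes_def)
    ultimately have "b i \<in> S" by (auto simp: S_def)
    from wfE_min[OF wf this] obtain v where
      v: "v \<in> S" "\<And>w. (w, v) \<in> (exit_rel X c)\<inverse> \<Longrightarrow> w \<notin> S" by blast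
    from v(1) obtain j where j: "j < n" "p j \<noteq> j" "v = b j" by (auto simp: S_def)
    have "p (p j) \<noteq> p j"
      using j permutes_inj[OF p(1)] by (auto dest: injD)
    then have "b (p j) \<in> S" using pn j by (auto simp: S_def)
    with v(2) step[OF j(1,2)] j show False by auto
  qed
  \<comment> \<open>Acyclicity excludes an exit along a loop, whose diagonal entry would cancel to
    0.\<close>
  have diag: "?M $$ (i, i) = (if c (b i) = None then x else 1)" if "i < n" for i
  proof (cases "c (b i)")
    case (Some e)
    then have "(b i, head X e) \<in> exit_rel X c" using bV that by (auto simp: exit_rel_def)
    then have "(b i, head X e) \<in> (exit_rel X c)\<^sup>+" by (rule r_into_trancl)
    then have "head X e \<noteq> b i" using ac unfolding acyclic_def by auto
    then show ?thesis using Some that by (simp add: vertex_mat_def exit_row_def)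
  qed (use that in \<open>simp add: vertex_mat_def exit_row_def\<close>)
  have "det ?M = (\<Sum>p\<in>{id}. signof p * (\<Prod>i = 0..<n. ?M $$ (i, p i)))"
    unfolding det_def'[OF vertex_mat_carrier]
    by (rule sum.mono_neutral_right) (auto simp: zero permutes_id finite_permutations)
  also have "\<dots> = (\<Prod>i = 0..<n. if c (b i) = None then x else 1)"
    by (auto simp: diag intro!: prod.cong)
  also have "\<dots> = (\<Prod>v\<in>verts X. if c v = None then x else 1)"
    by (rule prod.reindex_bij_betw[OF b])
  also have "\<dots> = x ^ card (exit_roots X c)"
    using finV by (simp add: prod.If_cases exit_roots_def Collect_conj_eq)
  finally show ?thesis .
qed

lemma det_exit_row_cyclic:
  fixes x :: "'a::idom"
  assumes b: "bij_betw b {0..<n} (verts X)" and cyc: "\<not> acyclic (exit_rel X c)"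
    and heads: "\<And>v e. v \<in> verts X \<Longrightarrow> c v = Some e \<Longrightarrow> head X e \<in> verts X"
  shows "det (vertex_mat n b (\<lambda>v. exit_row X x (c v) v)) = 0"
proof -
  let ?M = "vertex_mat n b (\<lambda>v. exit_row X x (c v) v)"
  let ?R = "exit_rel X c"
  have finV: "finite (verts X)" using b bij_betw_finite by blast
  have bV: "b r \<in> verts X" if "r < n" for r
    using b that by (auto simp: bij_betw_def)
  \<comment> \<open>The indicator of the vertices that run into a cycle is a kernel vector.\<close>
  define S where "S = {v. \<exists>w. (v, w) \<in> ?R\<^sup>* \<and> (w, w) \<in> ?R\<^sup>+}"
  \<comment> \<open>Every vertex has at most one exit, so a single successor in S already decides
    about all successors.\<close>
  have det_R: "u = u'" if "(v, u) \<in> ?R" "(v, u') \<in> ?R" for v u u'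
    using that by (auto simp: exit_rel_def)
  have S_iff: "v \<in> S \<longleftrightarrow> (\<exists>w. (v, w) \<in> ?R\<^sup>* \<and> (w, w) \<in> ?R\<^sup>+)" for v
    by (simp only: S_def mem_Collect_eq)
  have next_in: "c v \<noteq> None \<and> (\<forall>u. (v, u) \<in> ?R \<longrightarrow> u \<in> S)" if vS: "v \<in> S" for v
  proof -
    obtain w where w: "(v, w) \<in> ?R\<^sup>*" "(w, w) \<in> ?R\<^sup>+" using vS S_iff by metis
    then have "(v, w) \<in> ?R\<^sup>+" by (rule rtrancl_trancl_trancl)
    then obtain u' where u': "(v, u') \<in> ?R" "(u', w) \<in> ?R\<^sup>*"
      by (metis tranclD)
    then have "u' \<in> S" using w(2) S_iff by metis
    moreover have "c v \<noteq> None" using u'(1) by (auto simp: exit_rel_def)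
    ultimately show ?thesis using det_R[OF u'(1)] by metis
  qed
  have prev_in: "v \<in> S" if uS: "u \<in> S" and vu: "(v, u) \<in> ?R" for v u
  proof -
    obtain w where "(u, w) \<in> ?R\<^sup>*" "(w, w) \<in> ?R\<^sup>+" using uS S_iff by metis
    then show ?thesis using converse_rtrancl_into_rtrancl[OF vu] S_iff by metis
  qed
  have SV: "S \<inter> verts X \<noteq> {}"
  proof -
    obtain w where w: "(w, w) \<in> ?R\<^sup>+" using cyc unfolding acyclic_def by metis
    then have "w \<in> S" using S_iff rtrancl.rtrancl_refl by metis
    moreover obtain u where "(w, u) \<in> ?R" using w by (metis tranclD)
    then have "w \<in> verts X" by (auto simp: exit_rel_def)
    ultimately show ?thesis by auto
  qed
  have delta: "(\<Sum>w\<in>verts X. of_bool (w = y) * of_bool (w \<in> S)) = (of_bool (y \<in> S) :: 'a)"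
    if "y \<in> verts X" for y
  proof -
    have "(\<Sum>w\<in>verts X. of_bool (w = y) * of_bool (w \<in> S)) =
        (\<Sum>w\<in>verts X. if y = w then of_bool (y \<in> S) else (0 :: 'a))"
      by (intro sum.cong) auto
    then show ?thesis using finV that by simp
  qed
  define u :: "'a vec" where "u = vec n (\<lambda>r. of_bool (b r \<in> S))"
  have "?M *\<^sub>v u = 0\<^sub>v n"
  proof (rule eq_vecI)
    fix r assume "r < dim_vec (0\<^sub>v n :: 'a vec)"
    then have r: "r < n" by simp
    let ?v = "b r"
    have "(?M *\<^sub>v u) $ r = (\<Sum>s = 0..<n. exit_row X x (c ?v) ?v (b s) * of_bool (b s \<in> S))"
      using r by (auto simp: u_def vertex_mat_def scalar_prod_def intro!: sum.cong)
    also have "\<dots> = (\<Sum>w\<in>verts X. exit_row X x (c ?v) ?v w * of_bool (w \<in> S))"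
      by (rule sum.reindex_bij_betw[OF b])
    \<comment> \<open>A root lies outside S, so its row only meets a zero entry. The two ends of an
      exit lie both in S or both outside, so the row of an exit subtracts equal entries.\<close>
    also have "\<dots> = 0"
    proof (cases "c ?v")
      case None
      then have "?v \<notin> S" using next_in by metis
      then show ?thesis
        using None by (intro sum.neutral) (auto simp: exit_row_def)
    next
      case (Some e)
      then have e: "(?v, head X e) \<in> ?R" "head X e \<in> verts X"
        using bV[OF r] heads by (auto simp: exit_rel_def)
      then have iff: "?v \<in> S \<longleftrightarrow> head X e \<in> S" using next_in prev_in by metis
      have "(\<Sum>w\<in>verts X. exit_row X x (c ?v) ?v w * of_bool (w \<in> S)) =
          (\<Sum>w\<in>verts X. of_bool (w = ?v) * of_bool (w \<in> S)) -
          (\<Sum>w\<in>verts X. of_bool (w = head X e) * of_bool (w \<in> S) :: 'a)"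
        unfolding sum_subtractf[symmetric] using Some
        by (intro sum.cong) (auto simp: exit_row_def)
      also have "\<dots> = of_bool (?v \<in> S) - of_bool (head X e \<in> S)"
        using delta[OF bV[OF r]] delta[OF e(2)] by simp
      finally show ?thesis using iff by simp
    qed
    finally show "(?M *\<^sub>v u) $ r = (0\<^sub>v n) $ r" using r by simp
  qed (simp add: vertex_mat_def)
  moreover have "u \<noteq> 0\<^sub>v n"
  proof -
    obtain v where v: "v \<in> S" "v \<in> verts X" using SV by auto
    then obtain r where "r < n" "v = b r"
      using b unfolding bij_betw_def by (metis atLeastLessThan_iff imageE)
    then have "u $ r = 1" "(0\<^sub>v n :: 'a vec) $ r = 0" using v by (auto simp: u_def)
    then show ?thesis by auto
  qed
  moreover have "u \<in> carrier_vec n" by (simp add: u_def)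
  ultimately show ?thesis
    using det_0_iff_vec_prod_zero[OF vertex_mat_carrier] by blast
qed

text \<open>The forest version of the matrix-tree theorem: the rows of x I + L are expanded over all
  choices, and the choices with a cycle contribute 0.\<close>

theorem rooted_forest_expansion:
  fixes x :: "'a::idom"
  assumes X: "fin_digraph X" and b: "bij_betw b {0..<n} (verts X)"
  shows "det (x \<cdot>\<^sub>m 1\<^sub>m n - vertex_mat n b (neg_laplacian X)) =
    (\<Sum>c\<in>rooted_forests X. x ^ card (exit_roots X c))"
proof -
  interpret fin_digraph X by fact
  have binj: "b r = b s \<longleftrightarrow> r = s" if "r < n" "s < n" for r s
    using b that by (auto simp: bij_betw_def inj_on_def)
  have eq: "x \<cdot>\<^sub>m 1\<^sub>m n - vertex_mat n b (neg_laplacian X) =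
      vertex_mat n b (\<lambda>v w. \<Sum>a\<in>insert None (Some ` out_arcs X v). exit_row X x a v w)"
  proof (rule eq_matI)
    fix r s
    assume "r < dim_row (vertex_mat n b (\<lambda>v w. \<Sum>a\<in>insert None (Some ` out_arcs X v). exit_row X x a v w))"
      "s < dim_col (vertex_mat n b (\<lambda>v w. \<Sum>a\<in>insert None (Some ` out_arcs X v). exit_row X x a v w))"
    then have rs: "r < n" "s < n" by (auto simp: vertex_mat_def)
    then show "(x \<cdot>\<^sub>m 1\<^sub>m n - vertex_mat n b (neg_laplacian X)) $$ (r, s) =
        vertex_mat n b (\<lambda>v w. \<Sum>a\<in>insert None (Some ` out_arcs X v). exit_row X x a v w) $$ (r, s)"
      unfolding vertex_mat_def sum_exit_row[OF finite_out_arcs] using binj[OF rs] by simp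
  qed (simp_all add: vertex_mat_def)
  have "det (x \<cdot>\<^sub>m 1\<^sub>m n - vertex_mat n b (neg_laplacian X)) =
      (\<Sum>c\<in>exits X. det (vertex_mat n b (\<lambda>v. exit_row X x (c v) v)))"
    unfolding eq exits_def by (rule det_sum_rows[OF b]) auto
  also have "\<dots> = (\<Sum>c\<in>rooted_forests X. det (vertex_mat n b (\<lambda>v. exit_row X x (c v) v)))"
  proof (rule sum.mono_neutral_right)
    show "finite (exits X)" unfolding exits_def by (intro finite_PiE) auto
    show "\<forall>c\<in>exits X - rooted_forests X. det (vertex_mat n b (\<lambda>v. exit_row X x (c v) v)) = 0"
    proof
      fix c assume "c \<in> exits X - rooted_forests X"
      then have c: "c \<in> exits X" "\<not> acyclic (exit_rel X c)" by (auto simp: rooted_forests_def)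
      show "det (vertex_mat n b (\<lambda>v. exit_row X x (c v) v)) = 0"
      proof (rule det_exit_row_cyclic[OF b c(2)])
        fix v e assume "v \<in> verts X" "c v = Some e"
        then have "e \<in> out_arcs X v" using c(1) by (auto simp: exits_def PiE_iff)
        then show "head X e \<in> verts X" by auto
      qed
    qed
  qed (auto simp: rooted_forests_def)
  also have "\<dots> = (\<Sum>c\<in>rooted_forests X. x ^ card (exit_roots X c))"
    by (intro sum.cong det_exit_row_acyclic[OF b]) (auto simp: rooted_forests_def)
  finally show ?thesis .
qed

section \<open>Rooted trees and the complexity\<close>

lemma strongly_connected_imp_connected:
  assumes "strongly_connected X"
  shows "connected X"
proof -
  have "(u, v) \<in> rtrancl_on (verts X) ((arcs_ends X)\<^sup>s)"
    if "(u, v) \<in> rtrancl_on (verts X) (arcs_ends X)" for u v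
    by (rule rtrancl_on_mono[OF _ _ that]) (auto simp: symcl_def)
  then show ?thesis
    using assms by (auto simp: connected_conv strongly_connected_def reachable_def)
qed

text \<open>Reversing arcs by \<open>i\<close> supplies the symmetry under which connectedness
  implies strong connectedness, for whole graphs as well as for spanning trees.\<close>

lemma inversion_imp_symmetric:
  assumes "bidirected_digraph X i" "arcs T \<subseteq> arcs X" "i ` arcs T \<subseteq> arcs T"
    "tail T = tail X" "head T = head X"
  shows "symmetric T"
proof -
  interpret bidirected_digraph X i by fact
  have "(v, u) \<in> arcs_ends T" if uv: "(u, v) \<in> arcs_ends T" for u v
  proof -
    obtain e where e: "e \<in> arcs T" "u = tail X e" "v = head X e"
      using uv assms by (auto simp: arcs_ends_def arc_to_ends_def)
    then have "arc_to_ends T (i e) = (v, u)" "i e \<in> arcs T"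
      using assms by (auto simp: arc_to_ends_def)
    then show ?thesis unfolding arcs_ends_def by (metis image_eqI)
  qed
  then show ?thesis by (auto simp: symmetric_def sym_def)
qed

section \<open>The bijection between rooted trees and spanning trees\<close>

text \<open>Forgets the orientation. As \<open>i\<close> is an involution, the condition with
  \<open>i e\<close> collects the inverses of the exits, which makes the arc set closed under
  inversion.\<close>

definition exit_graph :: "('v, 'e) pre_digraph \<Rightarrow> ('e \<Rightarrow> 'e) \<Rightarrow> ('v \<Rightarrow> 'e option) \<Rightarrow> ('v, 'e) pre_digraph"
  where "exit_graph X i c = \<lparr>verts = verts X,
    arcs = {e. \<exists>v\<in>verts X. c v = Some e \<or> c v = Some (i e)}, tail = tail X, head = head X\<rparr>"

lemma exits_SomeD:
  assumes "c \<in> exits X" "v \<in> verts X" "c v = Some e"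
  shows "e \<in> arcs X" "tail X e = v"
proof -
  have "e \<in> out_arcs X v"
    using assms by (auto simp: exits_def PiE_iff)
  then show "e \<in> arcs X" "tail X e = v" by auto
qed

text \<open>Each head is the tail of the next arc, so tails and heads can differ only at the two
  ends. For u = v this makes both sets equal.\<close>

lemma closed_cas_tails_heads:
  assumes "pre_digraph.cas X u p v" "p \<noteq> []"
  shows "u \<in> tail X ` set p \<and> v \<in> head X ` set p \<and>
    tail X ` set p \<subseteq> insert u (head X ` set p) \<and> head X ` set p \<subseteq> insert v (tail X ` set p)"
  using assms
proof (induction p arbitrary: u)
  case (Cons e p)
  then show ?case
    by (cases p) (auto simp: pre_digraph.cas.simps)
qed simp

lemma cycle_tails_eq_heads:
  assumes "pre_digraph.cycle X p"
  shows "tail X ` set p = head X ` set p" "set p \<noteq> {}" "set p \<subseteq> arcs X"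
proof -
  obtain u where u: "pre_digraph.awalk X u p u" "p \<noteq> []"
    using assms by (auto simp: pre_digraph.cycle_def)
  then have "pre_digraph.cas X u p u" "set p \<subseteq> arcs X"
    by (auto simp: pre_digraph.awalk_def)
  then show "set p \<subseteq> arcs X" by simp
  show "set p \<noteq> {}" using u by simp
  show "tail X ` set p = head X ` set p"
    using closed_cas_tails_heads[OF \<open>pre_digraph.cas X u p u\<close> u(2)]
    by (metis insert_absorb subset_antisym)
qed

text \<open>A path visits no vertex twice. If one of the two arcs is the first of the path, the
  other one leads back to its tail, which the rest of the path avoids; the case e = f is that of a
  loop.\<close>

lemma (in wf_digraph) apath_no_inverse_arcs:
  assumes "apath u p v" "e \<in> set p" "f \<in> set p" "tail G f = head G e" "head G f = tail G e"
  shows False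
  using assms
proof (induction p arbitrary: u)
  case (Cons a p)
  then have ap: "apath (head G a) p v" "tail G a \<notin> set (awalk_verts (head G a) p)" "a \<in> arcs G"
    by (auto simp: apath_Cons_iff)
  then have aw: "awalk (head G a) p v" by (simp add: apath_def)
  have hd: "head G a \<in> set (awalk_verts (head G a) p)"
    using hd_in_awalk_verts(1)[OF aw] .
  consider "e = a" "f = a" | "e = a" "f \<in> set p" | "e \<in> set p" "f = a" | "e \<in> set p" "f \<in> set p"
    using Cons.prems by auto
  then show ?case
  proof cases
    case 1
    then show ?thesis using Cons.prems hd ap by simp
  next
    case 2
    then show ?thesis using awalk_verts_arc2[OF aw, of f] Cons.prems ap by simp
  next
    case 3
    then show ?thesis using awalk_verts_arc2[OF aw, of e] Cons.prems ap by simp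
  next
    case 4
    then show ?thesis using Cons.IH[OF ap(1)] Cons.prems by blast
  qed
qed simp

text \<open>Induction along this relation starts at the roots: a claim at v may assume the claim at
  the head of its exit.\<close>

lemma wf_exit_rel_converse:
  assumes "fin_digraph X" "c \<in> rooted_forests X"
  shows "wf ((exit_rel X c)\<inverse>)"
proof -
  interpret fin_digraph X by fact
  show ?thesis
    using assms(2) by (intro finite_acyclic_wf_converse finite_exit_rel) (auto simp: rooted_forests_def)
qed

text \<open>Exits lead every vertex to r, which gives connectedness. A circuit would have to run
  through some exit in both directions.\<close>

lemma exit_graph_in_spanning_trees:
  assumes bi: "bidirected_digraph X i" and fin: "fin_digraph X"
    and c: "c \<in> rooted_forests X" and r: "exit_roots X c = {r}"
  shows "exit_graph X i c \<in> spanning_trees X i"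
proof -
  interpret bidirected_digraph X i by fact
  interpret fin_digraph X by fact
  let ?T = "exit_graph X i c"
  have ce: "c \<in> exits X" and ac: "acyclic (exit_rel X c)"
    using c by (auto simp: rooted_forests_def)
  have T: "verts ?T = verts X" "tail ?T = tail X" "head ?T = head X"
    and arcs: "\<And>e. e \<in> arcs ?T \<longleftrightarrow> (\<exists>v\<in>verts X. c v = Some e \<or> c v = Some (i e))"
    by (auto simp: exit_graph_def)
  have sub: "arcs ?T \<subseteq> arcs X"
    using exits_SomeD(1)[OF ce] arev_in_arcs by (fastforce simp: arcs)
  have inv: "i ` arcs ?T \<subseteq> arcs ?T"
    by (auto simp: arcs)
  interpret T: wf_digraph ?T
    using sub by unfold_locales (auto simp: T)
  have span: "spanning ?T X"
    using sub T wf_digraph T.wf_digraph by (auto simp: spanning_def subgraph_def compatible_def)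
  have sym: "symmetric ?T"
    by (rule inversion_imp_symmetric[OF bi sub inv T(2,3)])
  have wf: "wf ((exit_rel X c)\<inverse>)" by (rule wf_exit_rel_converse[OF fin c])
  have to_root: "v \<in> verts X \<longrightarrow> v \<rightarrow>\<^sup>*\<^bsub>?T\<^esub> r" for v
  proof (induction v rule: wf_induct_rule[OF wf])
    case (1 v)
    show ?case
    proof
      assume v: "v \<in> verts X"
      show "v \<rightarrow>\<^sup>*\<^bsub>?T\<^esub> r"
      proof (cases "c v")
        case None
        then have "v = r" using v r by (auto simp: exit_roots_def)
        then show ?thesis using v T by auto
      next
        case (Some e)
        then have e: "e \<in> arcs ?T" "tail X e = v" "(v, head X e) \<in> exit_rel X c"
          using v exits_SomeD[OF ce v Some] by (auto simp: arcs exit_rel_def)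
        then have "v \<rightarrow>\<^bsub>?T\<^esub> head X e"
          by (intro T.dominatesI[of e]) (auto simp: arc_to_ends_def T)
        moreover have "head X e \<rightarrow>\<^sup>*\<^bsub>?T\<^esub> r"
          using 1[of "head X e"] e sub by auto
        ultimately show ?thesis by (rule T.adj_reachable_trans)
      qed
    qed
  qed
  have "strongly_connected ?T"
  proof
    show "verts ?T \<noteq> {}" using r T by (auto simp: exit_roots_def)
    fix u v assume "u \<in> verts ?T" "v \<in> verts ?T"
    then show "u \<rightarrow>\<^sup>*\<^bsub>?T\<^esub> v"
      using to_root[of u] symmetric_reachable[OF sym, of v r] to_root[of v] T
      by (auto intro: T.reachable_trans)
  qed
  then have conn: "connected ?T" by (rule strongly_connected_imp_connected)
  have "\<not> circuit ?T i p" for p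
  proof
    assume circ: "circuit ?T i p"
    then have cyc: "pre_digraph.cycle ?T p" and noinv: "\<And>e. e \<in> set p \<Longrightarrow> i e \<notin> set p"
      by (auto simp: circuit_def)
    note p = cycle_tails_eq_heads[OF cyc, unfolded T]
    \<comment> \<open>At a vertex \<open>w\<close> of the circuit that no other one exits to, both arcs of the circuit
      are traces of the exit from \<open>w\<close>.\<close>
    have wf': "wf (exit_rel X c)"
      using ac by (intro finite_acyclic_wf finite_exit_rel) auto
    have "hd p \<in> set p" using p(2) by simp
    from wfE_min[OF wf' imageI[of _ _ "tail X", OF this]] obtain w where
      w: "w \<in> tail X ` set p" "\<And>v. (v, w) \<in> exit_rel X c \<Longrightarrow> v \<notin> tail X ` set p" by metis
    obtain e where e: "e \<in> set p" "head X e = w" using w(1) p(1) by auto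
    obtain f where f: "f \<in> set p" "tail X f = w" using w(1) by auto
    have ef: "e \<in> arcs X" "f \<in> arcs X" "e \<in> arcs ?T" "f \<in> arcs ?T"
      using e f p(3) sub by auto
    have "c (tail X e) \<noteq> Some e"
    proof
      assume "c (tail X e) = Some e"
      then have "(tail X e, w) \<in> exit_rel X c" using e ef by (auto simp: exit_rel_def)
      then show False using w(2) e by blast
    qed
    moreover obtain v where "v \<in> verts X" "c v = Some e \<or> c v = Some (i e)"
      using ef(3) by (auto simp: arcs)
    ultimately have ce1: "c w = Some (i e)"
      using exits_SomeD(2)[OF ce] e ef by fastforce
    have "c (head X f) \<noteq> Some (i f)"
    proof
      assume "c (head X f) = Some (i f)"
      then have "(head X f, w) \<in> exit_rel X c"
        using f ef unfolding exit_rel_def by (auto intro!: exI[of _ "i f"])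
      moreover have "head X f \<in> tail X ` set p" using f p(1) by auto
      ultimately show False using w(2) by blast
    qed
    moreover obtain v where "v \<in> verts X" "c v = Some f \<or> c v = Some (i f)"
      using ef(4) by (auto simp: arcs)
    ultimately have "c w = Some f"
      using exits_SomeD(2)[OF ce] f ef by fastforce
    with ce1 have "f = i e" by simp
    then show False using noinv e f by blast
  qed
  then show ?thesis
    using span inv conn by (auto simp: spanning_trees_def)
qed

text \<open>Take v where c and d differ but agree at the head of the exit e of c at v. In the graph
  of d the arc e can only come from the exit \<open>i e\<close> at its head. There c agrees with d,
  so e and \<open>i e\<close> are both exits of c and form a cycle.\<close>

lemma exit_graph_inj:
  assumes bi: "bidirected_digraph X i" and fin: "fin_digraph X"
    and c: "c \<in> rooted_forests X" "exit_roots X c = {r}"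
    and d: "d \<in> rooted_forests X" "exit_roots X d = {r}"
    and eq: "exit_graph X i c = exit_graph X i d"
  shows "c = d"
proof (rule ccontr)
  assume "c \<noteq> d"
  interpret bidirected_digraph X i by fact
  have ce: "c \<in> exits X" and de: "d \<in> exits X" and ac: "acyclic (exit_rel X c)"
    using c d by (auto simp: rooted_forests_def)
  have arcs_eq: "{e. \<exists>v\<in>verts X. c v = Some e \<or> c v = Some (i e)} =
      {e. \<exists>v\<in>verts X. d v = Some e \<or> d v = Some (i e)}"
    using eq by (simp add: exit_graph_def)
  define S where "S = {v \<in> verts X. c v \<noteq> d v}"
  have "S \<noteq> {}"
  proof
    assume "S = {}"
    then have "c = d"
      using ce de unfolding exits_def S_def by (intro PiE_ext[of c "verts X" _ d]) auto
    with \<open>c \<noteq> d\<close> show False by simp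
  qed
  then obtain a where "a \<in> S" by auto
  from wfE_min[OF wf_exit_rel_converse[OF fin c(1)] this] obtain v where
    v: "v \<in> S" "\<And>w. (w, v) \<in> (exit_rel X c)\<inverse> \<Longrightarrow> w \<notin> S" by metis
  have vX: "v \<in> verts X" "c v \<noteq> d v" using v(1) by (auto simp: S_def)
  have none_iff: "c v = None \<longleftrightarrow> d v = None"
    using c(2) d(2) vX(1) by (auto simp: exit_roots_def)
  with vX obtain e where e: "c v = Some e" "d v \<noteq> Some e" by (cases "c v") auto
  note eX = exits_SomeD[OF ce vX(1) e(1)]
  have R: "(v, head X e) \<in> exit_rel X c" using e vX by (auto simp: exit_rel_def)
  then have nS: "head X e \<notin> S" using v(2) by auto
  have "e \<in> {e. \<exists>v\<in>verts X. d v = Some e \<or> d v = Some (i e)}"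
    using e vX unfolding arcs_eq[symmetric] by auto
  then obtain w where w: "w \<in> verts X" "d w = Some e \<or> d w = Some (i e)" by auto
  have "d w \<noteq> Some e"
    using exits_SomeD(2)[OF de w(1)] eX(2) e(2) by auto
  with w have dw: "d w = Some (i e)" by auto
  then have "w = head X e" using exits_SomeD(2)[OF de w(1) dw] eX by simp
  with nS w dw have "c w = Some (i e)" by (auto simp: S_def)
  then have "(head X e, v) \<in> exit_rel X c"
    using \<open>w = head X e\<close> w eX unfolding exit_rel_def by (auto intro!: exI[of _ "i e"])
  with R have "(v, v) \<in> (exit_rel X c)\<^sup>+" by (meson r_into_trancl trancl_into_trancl)
  then show False using ac by (auto simp: acyclic_def)
qed

text \<open>A breadth-first tree: every vertex other than r exits along an arc of T that lowers the
  distance to r, which rules out cycles. With T = X this yields the existence of a spanning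
  tree.\<close>

lemma exists_exits_in_connected_subgraph:
  assumes bi: "bidirected_digraph X i" and fin: "fin_digraph X"
    and T: "spanning T X" "i ` arcs T \<subseteq> arcs T" "connected T" and r: "r \<in> verts X"
  obtains c where "c \<in> rooted_forests X" "exit_roots X c = {r}"
    "arcs (exit_graph X i c) \<subseteq> arcs T"
proof -
  interpret bidirected_digraph X i by fact
  have sub: "arcs T \<subseteq> arcs X" "verts T = verts X" "tail T = tail X" "head T = head X" "wf_digraph T"
    using T(1) by (auto simp: spanning_def subgraph_def compatible_def)
  interpret T: wf_digraph T by fact
  have "symmetric T" by (rule inversion_imp_symmetric[OF bi sub(1) T(2) sub(3,4)])
  then have "strongly_connected T"
    using T(3) by (rule T.symmetric_connected_imp_strongly_connected)
  then have reach: "(v, r) \<in> (arcs_ends T)\<^sup>*" if "v \<in> verts X" for v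
    using that r sub(2) by (intro reachable_rtranclI) (simp add: strongly_connected_def)
  \<comment> \<open>The distance to r in T; \<open>LEAST\<close> is meaningful wherever
    \<open>reach\<close> provides some walk.\<close>
  define d where "d v = (LEAST k. (v, r) \<in> (arcs_ends T) ^^ k)" for v
  have "\<exists>e\<in>arcs T. tail X e = v \<and> d (head X e) < d v" if v: "v \<in> verts X" "v \<noteq> r" for v
  proof -
    obtain k where "(v, r) \<in> (arcs_ends T) ^^ k"
      using reach[OF v(1)] rtrancl_imp_relpow by blast
    then have dv: "(v, r) \<in> (arcs_ends T) ^^ d v"
      unfolding d_def by (rule LeastI)
    with v(2) obtain m where m: "d v = Suc m" by (cases "d v") auto
    with dv obtain u where u: "(v, u) \<in> arcs_ends T" "(u, r) \<in> (arcs_ends T) ^^ m"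
      by (metis relpow_Suc_D2)
    then obtain e where e: "e \<in> arcs T" "tail X e = v" "head X e = u"
      using sub by (auto simp: arcs_ends_def arc_to_ends_def)
    have "d u \<le> m" unfolding d_def using u(2) by (rule Least_le)
    with e m show ?thesis by auto
  qed
  then obtain g where g: "\<And>v. v \<in> verts X \<Longrightarrow> v \<noteq> r \<Longrightarrow>
      g v \<in> arcs T \<and> tail X (g v) = v \<and> d (head X (g v)) < d v"
    by metis
  define c where "c = (\<lambda>v\<in>verts X. if v = r then None else Some (g v))"
  have "g v \<in> out_arcs X v" if "v \<in> verts X" "v \<noteq> r" for v
    using g[OF that] sub(1) by (simp add: out_arcs_def subset_iff)
  then have "c \<in> exits X"
    by (simp add: exits_def c_def restrict_PiE_iff)
  moreover have "acyclic (exit_rel X c)"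
  proof -
    have "exit_rel X c \<subseteq> (Wellfounded.measure d)\<inverse>"
      using g by (auto simp: exit_rel_def c_def split: if_splits)
    moreover have "acyclic ((Wellfounded.measure d)\<inverse>)"
      by (simp add: wf_acyclic)
    ultimately show ?thesis by (rule acyclic_subset[rotated])
  qed
  moreover have "exit_roots X c = {r}"
    using r by (auto simp: exit_roots_def c_def split: if_splits)
  moreover have "arcs (exit_graph X i c) \<subseteq> arcs T"
  proof
    fix e assume "e \<in> arcs (exit_graph X i c)"
    then obtain v where v: "v \<in> verts X" "c v = Some e \<or> c v = Some (i e)"
      by (auto simp: exit_graph_def)
    then have "v \<noteq> r" "e = g v \<or> i e = g v"
      by (auto simp: c_def split: if_splits)
    then have "e \<in> arcs T \<or> i e \<in> arcs T"
      using g v(1) by metis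
    then show "e \<in> arcs T" using T(2) arev_arev by (metis image_eqI subsetD)
  qed
  ultimately show ?thesis by (intro that[of c]) (auto simp: rooted_forests_def)
qed

text \<open>The exits found inside T already produce all of T: a further arc e, together with a path
  in the exit graph from its head back to its tail, would be a circuit of T.\<close>

lemma exit_graph_surj:
  assumes bi: "bidirected_digraph X i" and fin: "fin_digraph X"
    and T: "T \<in> spanning_trees X i" and r: "r \<in> verts X"
  obtains c where "c \<in> rooted_forests X" "exit_roots X c = {r}" "exit_graph X i c = T"
proof -
  interpret bidirected_digraph X i by fact
  have T': "spanning T X" "i ` arcs T \<subseteq> arcs T" "connected T" "\<And>p. \<not> circuit T i p"
    using T by (auto simp: spanning_trees_def)
  have sub: "arcs T \<subseteq> arcs X" "verts T = verts X" "tail T = tail X" "head T = head X" "wf_digraph T"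
    using T'(1) by (auto simp: spanning_def subgraph_def compatible_def)
  interpret T: wf_digraph T by fact
  obtain c where c: "c \<in> rooted_forests X" "exit_roots X c = {r}"
    "arcs (exit_graph X i c) \<subseteq> arcs T"
    using exists_exits_in_connected_subgraph[OF bi fin T'(1-3) r] .
  let ?S = "exit_graph X i c"
  have S: "spanning ?S X" "i ` arcs ?S \<subseteq> arcs ?S" "connected ?S"
    using exit_graph_in_spanning_trees[OF bi fin c(1,2)] by (auto simp: spanning_trees_def)
  have subS: "arcs ?S \<subseteq> arcs X" "verts ?S = verts X" "tail ?S = tail X" "head ?S = head X"
    "wf_digraph ?S"
    using S(1) by (auto simp: spanning_def subgraph_def compatible_def)
  interpret S: wf_digraph ?S by fact
  have "symmetric ?S" by (rule inversion_imp_symmetric[OF bi subS(1) S(2) subS(3,4)])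
  then have sc: "strongly_connected ?S"
    using S(3) by (rule S.symmetric_connected_imp_strongly_connected)
  have subST: "subgraph ?S T"
    using c(3) sub subS by (auto simp: subgraph_def compatible_def)
  have "arcs T \<subseteq> arcs ?S"
  proof
    fix e assume e: "e \<in> arcs T"
    show "e \<in> arcs ?S"
    proof (rule ccontr)
      assume ne: "e \<notin> arcs ?S"
      have ie: "i e \<notin> arcs ?S"
        using ne S(2) arev_arev by (metis image_eqI subsetD)
      have eX: "e \<in> arcs X" using e sub by auto
      have "head X e \<rightarrow>\<^sup>*\<^bsub>?S\<^esub> tail X e"
        using sc eX subS(2) by (auto simp: strongly_connected_def)
      \<comment> \<open>A path rather than a walk: this gives the distinct vertices of the cycle and
        excludes inverse pairs of arcs.\<close>
      then obtain p where p: "S.apath (head X e) p (tail X e)"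
        using S.reachable_apath by blast
      have pS: "set p \<subseteq> arcs ?S" using p by (auto simp: S.apath_def)
      have "T.awalk (head X e) p (tail X e)"
        using p by (intro T.subgraph_awalk_imp_awalk[OF _ subST]) (simp add: S.apath_def)
      then have "T.awalk (tail X e) (e # p) (tail X e)"
        using e sub by (simp add: T.awalk_Cons_iff)
      moreover have "distinct (tl (T.awalk_verts (tail X e) (e # p)))"
      proof -
        have "T.awalk_verts (head X e) p = S.awalk_verts (head X e) p"
          using compatible_awalk_verts[of T ?S] sub subS by (simp add: compatible_def)
        then show ?thesis using p sub by (simp add: S.apath_def)
      qed
      ultimately have "T.cycle (e # p)" by (auto simp: T.cycle_def)
      \<comment> \<open>The inverse of e is not on the path, which stays in the exit graph, and the
        path itself contains no two mutually inverse arcs.\<close>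
      moreover have "i f \<notin> set (e # p)" if f: "f \<in> set (e # p)" for f
      proof (cases "f = e")
        case True
        then show ?thesis using ie pS arev_neq[OF eX] by auto
      next
        case False
        then have fp: "f \<in> set p" using f by simp
        then have fS: "f \<in> arcs ?S" "f \<in> arcs X" using pS subS by auto
        then have "i f \<in> arcs ?S" using S(2) by auto
        then have "i f \<noteq> e" using ne by auto
        moreover have "i f \<notin> set p"
          using S.apath_no_inverse_arcs[OF p fp, of "i f"] fS subS by auto
        ultimately show ?thesis by simp
      qed
      ultimately have "circuit T i (e # p)" by (simp add: circuit_def)
      with T'(4) show False by blast
    qed
  qed
  with c(3) sub subS have "?S = T"
    by (intro pre_digraph.equality) auto
  with c that show ?thesis by blast
qed

lemma finite_exits: "fin_digraph X \<Longrightarrow> finite (exits X)"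
  unfolding exits_def
  by (intro finite_PiE) (auto simp: fin_digraph.finite_verts intro: fin_digraph.finite_out_arcs)

lemma finite_rooted_forests: "fin_digraph X \<Longrightarrow> finite (rooted_forests X)"
  by (rule finite_subset[of _ "exits X"]) (auto simp: rooted_forests_def finite_exits)

lemma card_trees_rooted_at:
  assumes bi: "bidirected_digraph X i" and fin: "fin_digraph X" and r: "r \<in> verts X"
  shows "card {c \<in> rooted_forests X. exit_roots X c = {r}} = complexity X i"
  unfolding complexity_def
proof (rule bij_betw_same_card[of "exit_graph X i"], rule bij_betw_imageI)
  show "inj_on (exit_graph X i) {c \<in> rooted_forests X. exit_roots X c = {r}}"
    using exit_graph_inj[OF bi fin] by (auto intro!: inj_onI)
  show "exit_graph X i ` {c \<in> rooted_forests X. exit_roots X c = {r}} = spanning_trees X i"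
  proof (intro equalityI subsetI)
    fix T assume "T \<in> exit_graph X i ` {c \<in> rooted_forests X. exit_roots X c = {r}}"
    then show "T \<in> spanning_trees X i"
      using exit_graph_in_spanning_trees[OF bi fin, of _ r] by blast
  next
    fix T assume "T \<in> spanning_trees X i"
    from exit_graph_surj[OF bi fin this r] obtain c where
      "c \<in> rooted_forests X" "exit_roots X c = {r}" "exit_graph X i c = T" .
    then show "T \<in> exit_graph X i ` {c \<in> rooted_forests X. exit_roots X c = {r}}"
      by blast
  qed
qed

lemma card_rooted_trees:
  assumes bi: "bidirected_digraph X i" and fin: "fin_digraph X"
  shows "card {c \<in> rooted_forests X. card (exit_roots X c) = 1} = card (verts X) * complexity X i"
proof -
  interpret fin_digraph X by fact
  have "{c \<in> rooted_forests X. card (exit_roots X c) = 1} =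
      (\<Union>r\<in>verts X. {c \<in> rooted_forests X. exit_roots X c = {r}})"
    by (auto simp: card_1_singleton_iff) (auto simp: exit_roots_def)
  moreover have "card \<dots> = (\<Sum>r\<in>verts X. card {c \<in> rooted_forests X. exit_roots X c = {r}})"
    using finite_rooted_forests[OF fin] by (intro card_UN_disjoint) auto
  ultimately show ?thesis
    by (simp add: card_trees_rooted_at[OF bi fin])
qed

lemma complexity_pos:
  assumes bi: "bidirected_digraph X i" and fin: "fin_digraph X" and conn: "connected X"
  shows "complexity X i > 0"
proof -
  interpret bidirected_digraph X i by fact
  obtain r where r: "r \<in> verts X"
    using conn by (auto simp: connected_conv)
  have "spanning X X"
    using wf_digraph by (auto simp: spanning_def subgraph_def compatible_def)
  moreover have "i ` arcs X \<subseteq> arcs X" by auto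
  ultimately obtain c where "c \<in> rooted_forests X" "exit_roots X c = {r}"
    by (rule exists_exits_in_connected_subgraph[OF bi fin _ _ conn r])
  then have "card {c \<in> rooted_forests X. exit_roots X c = {r}} > 0"
    using finite_rooted_forests[OF fin] by (auto simp: card_gt_0_iff)
  then show ?thesis by (simp add: card_trees_rooted_at[OF bi fin r])
qed

text \<open>Exits cannot be followed forever in a finite acyclic relation. So every forest
  contributes a positive power of x, and division by x leaves a polynomial.\<close>

lemma exit_roots_nonempty:
  assumes fin: "fin_digraph X" and ne: "verts X \<noteq> {}" and c: "c \<in> rooted_forests X"
  shows "card (exit_roots X c) > 0"
proof -
  interpret fin_digraph X by fact
  obtain a where "a \<in> verts X" using ne by auto
  from wfE_min[OF wf_exit_rel_converse[OF fin c] this] obtain v where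
    v: "v \<in> verts X" "\<And>w. (w, v) \<in> (exit_rel X c)\<inverse> \<Longrightarrow> w \<notin> verts X" by metis
  have "c v = None"
  proof (rule ccontr)
    assume "c v \<noteq> None"
    then obtain e where e: "c v = Some e" by auto
    then have "e \<in> arcs X" using c v(1) exits_SomeD(1) by (fastforce simp: rooted_forests_def)
    moreover have "(v, head X e) \<in> exit_rel X c" using v(1) e by (auto simp: exit_rel_def)
    ultimately show False using v(2)[of "head X e"] by simp
  qed
  then have "v \<in> exit_roots X c" using v(1) by (simp add: exit_roots_def)
  moreover have "finite (exit_roots X c)" by (simp add: exit_roots_def)
  ultimately show ?thesis by (auto simp: card_gt_0_iff)
qed

section \<open>The forest polynomial near zero\<close>

text \<open>The function \<open>F_X\<close> with real values, ready for \<open>ln\<close>; the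
  determinants themselves are complex because of the eigenvalues.\<close>

definition forest_poly :: "('v, 'e) pre_digraph \<Rightarrow> real \<Rightarrow> real" where
  "forest_poly X x = (\<Sum>c\<in>rooted_forests X. x ^ card (exit_roots X c))"

lemma det_eq_forest_poly:
  assumes "fin_digraph X" "bij_betw b {0..<n} (verts X)"
  shows "det (of_real x \<cdot>\<^sub>m 1\<^sub>m n - vertex_mat n b (neg_laplacian X)) =
    (of_real (forest_poly X x) :: complex)"
  by (simp add: rooted_forest_expansion[OF assms] forest_poly_def)

lemma forest_poly_pos:
  assumes "bidirected_digraph X i" "fin_digraph X" "connected X" "x > 0"
  shows "forest_poly X x > 0"
  unfolding forest_poly_def
proof (rule sum_pos)
  interpret bidirected_digraph X i by fact
  show "finite (rooted_forests X)" using finite_rooted_forests assms by blast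
  obtain r where "r \<in> verts X" using assms(3) by (auto simp: connected_conv)
  then have "card {c \<in> rooted_forests X. exit_roots X c = {r}} > 0"
    using complexity_pos[OF assms(1-3)] by (simp add: card_trees_rooted_at[OF assms(1,2)])
  then show "rooted_forests X \<noteq> {}" by (auto simp: card_gt_0_iff)
qed (use assms in auto)

lemma forest_poly_asymptotics:
  assumes bi: "bidirected_digraph X i" and fin: "fin_digraph X" and conn: "connected X"
  shows "((\<lambda>x. forest_poly X x / x) \<longlongrightarrow> card (verts X) * complexity X i) (at_right 0)"
proof -
  have ne: "verts X \<noteq> {}" using conn by (auto simp: connected_conv)
  have pos: "card (exit_roots X c) > 0" if "c \<in> rooted_forests X" for c
    by (rule exit_roots_nonempty[OF fin ne that])
  have eq: "forest_poly X x / x = (\<Sum>c\<in>rooted_forests X. x ^ (card (exit_roots X c) - 1))"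
    if "x > 0" for x
    unfolding forest_poly_def sum_divide_distrib
  proof (rule sum.cong)
    fix c assume "c \<in> rooted_forests X"
    then obtain m where "card (exit_roots X c) = Suc m" using pos gr0_implies_Suc by blast
    then show "x ^ card (exit_roots X c) / x = x ^ (card (exit_roots X c) - 1)"
      using that by simp
  qed simp
  have "((\<lambda>x::real. \<Sum>c\<in>rooted_forests X. x ^ (card (exit_roots X c) - 1)) \<longlongrightarrow>
      (\<Sum>c\<in>rooted_forests X. 0 ^ (card (exit_roots X c) - 1))) (at_right 0)"
    by (intro tendsto_intros)
  \<comment> \<open>As \<open>0 ^ 0 = 1\<close>, the limit counts exactly the forests with a single
    root.\<close>
  also have "(\<Sum>c\<in>rooted_forests X. 0 ^ (card (exit_roots X c) - 1)) =
      (\<Sum>c\<in>rooted_forests X. if card (exit_roots X c) = 1 then 1 else (0::real))"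
  proof (rule sum.cong)
    fix c assume "c \<in> rooted_forests X"
    from pos[OF this] show "0 ^ (card (exit_roots X c) - 1) =
        (if card (exit_roots X c) = 1 then 1 else (0::real))"
      by (cases "card (exit_roots X c) - 1") auto
  qed simp
  also have "\<dots> = real (card {c \<in> rooted_forests X. card (exit_roots X c) = 1})"
    using finite_rooted_forests[OF fin] by (simp add: sum.If_cases Collect_conj_eq)
  also have "\<dots> = real (card (verts X) * complexity X i)"
    by (simp only: card_rooted_trees[OF bi fin])
  finally show ?thesis
    by (rule Lim_transform_eventually)
       (auto simp: eq eventually_at_filter)
qed

section \<open>Moebius inversion over the cyclic subgroups\<close>

lemma moebius_eq_0: "\<not> x \<le> y \<Longrightarrow> moebius L x y = 0"
  by (subst moebius.simps) (auto simp: less_le)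

lemma moebius_refl: "finite L \<Longrightarrow> x \<in> L \<Longrightarrow> moebius L x x = 1"
  by (subst moebius.simps) simp

text \<open>The defining recursion as a matrix identity: the Moebius matrix is a left inverse of the
  zeta matrix of the order.\<close>

lemma sum_moebius_right:
  fixes L :: "'a::order set"
  assumes "finite L" "x \<in> L" "y \<in> L"
  shows "(\<Sum>z\<in>L. moebius L x z * of_bool (z \<le> y)) = of_bool (x = y)"
proof -
  have "(\<Sum>z\<in>L. moebius L x z * of_bool (z \<le> y)) = (\<Sum>z\<in>{z\<in>L. x \<le> z \<and> z \<le> y}. moebius L x z)"
    using assms(1) by (intro sum.mono_neutral_cong_right) (auto, metis moebius_eq_0)
  also have "\<dots> = of_bool (x = y)"
  proof -
    consider "x = y" | "x < y" | "\<not> x \<le> y" by (auto simp: less_le)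
    then show ?thesis
    proof cases
      case 1
      then have "{z\<in>L. x \<le> z \<and> z \<le> y} = {x}" using assms by auto
      then show ?thesis using assms 1 by (simp add: moebius_refl)
    next
      case 2
      then have "{z\<in>L. x \<le> z \<and> z \<le> y} = insert y {z\<in>L. x \<le> z \<and> z < y}"
        using assms by (auto simp: less_le)
      moreover have "moebius L x y = - (\<Sum>z\<in>{z\<in>L. x \<le> z \<and> z < y}. moebius L x z)"
        using assms 2 by (subst moebius.simps) auto
      ultimately show ?thesis using assms(1) 2 by simp
    next
      case 3
      then have empty: "{z\<in>L. x \<le> z \<and> z \<le> y} = {}" by (auto dest: order_trans)
      show ?thesis unfolding empty using 3 by auto
    qed
  qed
  finally show ?thesis .
qed

text \<open>
  The recursion for \<^const>\<open>moebius\<close> runs over its second argument.  For the dual recursion, the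
  deviation \<open>D\<close> is shown to be annihilated by the unitriangular matrix of \<^const>\<open>moebius\<close>.
\<close>
lemma sum_moebius_left:
  fixes L :: "'a::order set"
  assumes fin: "finite L" and y: "y \<in> L" and x: "x \<in> L"
  shows "(\<Sum>z\<in>L. of_bool (x \<le> z) * moebius L z y) = of_bool (x = y)"
proof -
  define D where "D x = (\<Sum>z\<in>L. of_bool (x \<le> z) * moebius L z y) - of_bool (x = y)" for x
  \<comment> \<open>With the zeta matrix z this is mu (z mu - 1) = (mu z) mu - mu = 0.\<close>
  have annih: "(\<Sum>u\<in>L. moebius L x u * D u) = 0" if "x \<in> L" for x
  proof -
    have "(\<Sum>u\<in>L. moebius L x u * D u) =
        (\<Sum>u\<in>L. \<Sum>z\<in>L. moebius L x u * of_bool (u \<le> z) * moebius L z y) -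
        (\<Sum>u\<in>L. moebius L x u * of_bool (u = y))"
      by (simp add: D_def right_diff_distrib sum_subtractf sum_distrib_left mult.assoc)
    also have "(\<Sum>u\<in>L. \<Sum>z\<in>L. moebius L x u * of_bool (u \<le> z) * moebius L z y) =
        (\<Sum>z\<in>L. (\<Sum>u\<in>L. moebius L x u * of_bool (u \<le> z)) * moebius L z y)"
      by (subst sum.swap) (simp add: sum_distrib_right)
    also have "\<dots> = (\<Sum>z\<in>L. of_bool (x = z) * moebius L z y)"
      using fin that by (intro sum.cong refl arg_cong2[where f = "(*)"] sum_moebius_right)
    also have "\<dots> = (\<Sum>z\<in>L. if x = z then moebius L x y else 0)"
      by (intro sum.cong) auto
    also have "\<dots> = moebius L x y" using fin that by simp
    also have "(\<Sum>u\<in>L. moebius L x u * of_bool (u = y)) = (\<Sum>u\<in>L. if y = u then moebius L x y else 0)"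
      by (intro sum.cong) auto
    also have "\<dots> = moebius L x y" using fin y by simp
    finally show ?thesis by simp
  qed
  \<comment> \<open>Induction from the top of the poset: the deviation vanishes at all larger
    elements, and the remaining coefficient is mu(x, x) = 1.\<close>
  have "D x = 0" using x
  proof (induction "card {z\<in>L. x < z}" arbitrary: x rule: less_induct)
    case less
    have "moebius L x u * D u = 0" if u: "u \<in> L - {x}" for u
    proof (cases "x < u")
      case True
      then have "{z\<in>L. u < z} \<subset> {z\<in>L. x < z}" using u by auto
      then have "card {z\<in>L. u < z} < card {z\<in>L. x < z}"
        using fin by (intro psubset_card_mono) auto
      then show ?thesis using less.hyps u by auto
    next
      case False
      then have "\<not> x \<le> u" using u by (auto simp: less_le)
      then show ?thesis by (simp add: moebius_eq_0)
    qed
    then have "(\<Sum>u\<in>L - {x}. moebius L x u * D u) = 0"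
      by (intro sum.neutral) blast
    then have "(\<Sum>u\<in>L. moebius L x u * D u) = moebius L x x * D x"
      using fin less.prems by (simp add: sum.remove[of L x])
    then show ?case using annih[of x] less.prems fin by (simp add: moebius_refl)
  qed
  then show ?thesis by (simp add: D_def)
qed

section \<open>The cyclic subgroups with a top adjoined\<close>

lemma (in group) finite_cyclic_subgroups:
  "finite (carrier G) \<Longrightarrow> finite (cyclic_subgroups G)"
  by (rule finite_subset[of _ "Pow (carrier G)"])
     (auto simp: cyclic_subgroups_def dest: subgroup.mem_carrier)

text \<open>The cyclic subgroups containing g are those above the one generated by g. The dual
  recursion from there up to the top has sum 0, and the top itself accounts for 1.\<close>

lemma (in group) sum_moebius_cyclic_subgroups:
  assumes fin: "finite (carrier G)" and g: "g \<in> carrier G"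
  shows "(\<Sum>C\<in>{C\<in>cyclic_subgroups G. g \<in> C}. moebius (cyclic_subgroups_top G) (Fin C) Pinf) = - 1"
proof -
  let ?L = "cyclic_subgroups_top G" and ?g = "generate G {g}"
  have finL: "finite ?L"
    using finite_cyclic_subgroups[OF fin] by (simp add: cyclic_subgroups_top_def)
  have "?g \<in> cyclic_subgroups G"
    using generate_is_subgroup[of "{g}"] cyclic_group_generated[of g] g
    by (simp add: cyclic_subgroups_def subgroup_generated_def)
  then have gL: "Fin ?g \<in> ?L" by (simp add: cyclic_subgroups_top_def)
  have le: "?g \<subseteq> C \<longleftrightarrow> g \<in> C" if "C \<in> cyclic_subgroups G" for C
    using that generate_subgroup_incl[of "{g}" C] generate.incl[of g "{g}" G]
    by (auto simp: cyclic_subgroups_def)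
  have "0 = (\<Sum>z\<in>?L. of_bool (Fin ?g \<le> z) * moebius ?L z Pinf)"
    using sum_moebius_left[OF finL _ gL, of Pinf] by (simp add: cyclic_subgroups_top_def)
  also have "\<dots> = moebius ?L Pinf Pinf +
      (\<Sum>z\<in>Fin ` cyclic_subgroups G. of_bool (Fin ?g \<le> z) * moebius ?L z Pinf)"
    using finL by (subst (1) cyclic_subgroups_top_def, subst sum.insert)
      (auto simp: cyclic_subgroups_top_def)
  also have "moebius ?L Pinf Pinf = 1"
    using finL by (intro moebius_refl) (auto simp: cyclic_subgroups_top_def)
  also have "(\<Sum>z\<in>Fin ` cyclic_subgroups G. of_bool (Fin ?g \<le> z) * moebius ?L z Pinf) =
      (\<Sum>C\<in>cyclic_subgroups G. of_bool (g \<in> C) * moebius ?L (Fin C) Pinf)"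
    by (subst sum.reindex) (auto simp: le inj_on_def intro!: sum.cong)
  also have "\<dots> = (\<Sum>C\<in>{C\<in>cyclic_subgroups G. g \<in> C}. moebius ?L (Fin C) Pinf)"
    using finite_cyclic_subgroups[OF fin] by (intro sum.mono_neutral_cong_right) auto
  finally show ?thesis by simp
qed

text \<open>This replaces Artin's induction formula for the trivial character of \<open>G\<close>.\<close>
lemma (in group) sum_via_cyclic_subgroups:
  fixes f :: "'a \<Rightarrow> 'c::comm_ring_1"
  assumes fin: "finite (carrier G)"
  shows "(\<Sum>C\<in>cyclic_subgroups G. - of_int (moebius (cyclic_subgroups_top G) (Fin C) Pinf) *
    (\<Sum>g\<in>C. f g)) = (\<Sum>g\<in>carrier G. f g)"
proof -
  let ?\<mu> = "\<lambda>C. moebius (cyclic_subgroups_top G) (Fin C) Pinf"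
  note finC = finite_cyclic_subgroups[OF fin]
  have sub: "C \<subseteq> carrier G" if "C \<in> cyclic_subgroups G" for C
    using that by (auto simp: cyclic_subgroups_def dest: subgroup.mem_carrier)
  have "(\<Sum>C\<in>cyclic_subgroups G. - of_int (?\<mu> C) * (\<Sum>g\<in>C. f g)) =
      (\<Sum>C\<in>cyclic_subgroups G. \<Sum>g\<in>{g\<in>carrier G. g \<in> C}. - of_int (?\<mu> C) * f g)"
    unfolding sum_distrib_left using sub by (intro sum.cong) auto
  also have "\<dots> = (\<Sum>g\<in>carrier G. \<Sum>C\<in>{C\<in>cyclic_subgroups G. g \<in> C}. - of_int (?\<mu> C) * f g)"
    by (rule sum.swap_restrict[OF finC fin])
  also have "\<dots> = (\<Sum>g\<in>carrier G. - of_int (\<Sum>C\<in>{C\<in>cyclic_subgroups G. g \<in> C}. ?\<mu> C) * f g)"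
    by (simp add: sum_distrib_right sum_negf)
  also have "\<dots> = (\<Sum>g\<in>carrier G. f g)"
    by (intro sum.cong) (simp_all add: sum_moebius_cyclic_subgroups[OF fin])
  finally show ?thesis .
qed

section \<open>Power traces of quotients\<close>

text \<open>Matrix powers indexed by the vertices themselves, so that a graph and its quotient can
  be compared without enumerations.\<close>

primrec kernel_pow :: "'v set \<Rightarrow> ('v \<Rightarrow> 'v \<Rightarrow> 'a::comm_ring_1) \<Rightarrow> nat \<Rightarrow> 'v \<Rightarrow> 'v \<Rightarrow> 'a" where
  "kernel_pow V L 0 v w = of_bool (v = w)"
| "kernel_pow V L (Suc k) v w = (\<Sum>u\<in>V. kernel_pow V L k v u * L u w)"

lemma vertex_mat_pow:
  assumes b: "bij_betw b {0..<n} V"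
  shows "vertex_mat n b L ^\<^sub>m k = vertex_mat n b (kernel_pow V L k)"
proof (induction k)
  case 0
  have "b r = b s \<longleftrightarrow> r = s" if "r < n" "s < n" for r s
    using b that by (auto simp: bij_betw_def inj_on_def)
  then show ?case by (intro eq_matI) (auto simp: vertex_mat_def)
next
  case (Suc k)
  show ?case
  proof (rule eq_matI)
    fix r s
    assume "r < dim_row (vertex_mat n b (kernel_pow V L (Suc k)))"
      "s < dim_col (vertex_mat n b (kernel_pow V L (Suc k)))"
    then have rs: "r < n" "s < n" by (auto simp: vertex_mat_def)
    then have "(vertex_mat n b L ^\<^sub>m Suc k) $$ (r, s) =
        (\<Sum>t = 0..<n. kernel_pow V L k (b r) (b t) * L (b t) (b s))"
      by (simp add: Suc) (simp add: vertex_mat_def scalar_prod_def)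
    also have "\<dots> = (\<Sum>u\<in>V. kernel_pow V L k (b r) u * L u (b s))"
      by (rule sum.reindex_bij_betw[OF b])
    finally show "(vertex_mat n b L ^\<^sub>m Suc k) $$ (r, s) =
        vertex_mat n b (kernel_pow V L (Suc k)) $$ (r, s)"
      using rs by (simp add: vertex_mat_def)
  qed (simp_all add: Suc vertex_mat_def)
qed

lemma mat_trace_vertex_mat_pow:
  assumes b: "bij_betw b {0..<n} V"
  shows "mat_trace (vertex_mat n b L ^\<^sub>m k) = (\<Sum>v\<in>V. kernel_pow V L k v v)"
proof -
  have "mat_trace (vertex_mat n b L ^\<^sub>m k) = (\<Sum>r = 0..<n. kernel_pow V L k (b r) (b r))"
    unfolding vertex_mat_pow[OF b]
    by (simp add: mat_trace_def vertex_mat_def atLeast0LessThan)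
  also have "\<dots> = (\<Sum>v\<in>V. kernel_pow V L k v v)"
    by (rule sum.reindex_bij_betw[OF b])
  finally show ?thesis .
qed

text \<open>
  \<open>Z\<close> is the quotient of \<open>Y\<close> by \<open>H\<close>, which acts freely on the vertices, and \<open>(q, qa)\<close>
  is the covering map.
\<close>
locale free_quotient = Y: fin_digraph Y + Z: fin_digraph Z
  for Y :: "('v, 'e) pre_digraph" and Z :: "('w, 'f) pre_digraph" +
  fixes q :: "'v \<Rightarrow> 'w" and qa :: "'e \<Rightarrow> 'f" and H :: "'g set" and act :: "'g \<Rightarrow> 'v \<Rightarrow> 'v"
  assumes onto: "q ` verts Y = verts Z"
    and out_bij: "w \<in> verts Y \<Longrightarrow> bij_betw qa (out_arcs Y w) (out_arcs Z (q w))"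
    and heads: "e \<in> arcs Y \<Longrightarrow> head Z (qa e) = q (head Y e)"
    and fibre: "w \<in> verts Y \<Longrightarrow> bij_betw (\<lambda>g. act g w) H {w' \<in> verts Y. q w' = q w}"
begin

lemma card_fibre: "z \<in> verts Z \<Longrightarrow> card {w \<in> verts Y. q w = z} = card H"
proof -
  assume "z \<in> verts Z"
  then obtain w where "w \<in> verts Y" "z = q w" using onto by (metis imageE)
  then show ?thesis using bij_betw_same_card[OF fibre] by simp
qed

lemma sum_over_fibres:
  fixes f :: "'w \<Rightarrow> 'a::comm_ring_1"
  shows "(\<Sum>w\<in>verts Y. f (q w)) = of_nat (card H) * (\<Sum>z\<in>verts Z. f z)"
proof -
  have "(\<Sum>w\<in>verts Y. f (q w)) = (\<Sum>z\<in>verts Z. \<Sum>w\<in>{w \<in> verts Y. q w = z}. f (q w))"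
    by (rule sum.group[symmetric]) (auto simp: onto)
  also have "\<dots> = (\<Sum>z\<in>verts Z. of_nat (card H) * f z)"
    by (intro sum.cong) (simp_all add: card_fibre)
  finally show ?thesis by (simp add: sum_distrib_left)
qed

lemma card_verts: "card (verts Y) = card H * card (verts Z)"
proof -
  have "int (card (verts Y)) = int (card H * card (verts Z))"
    using sum_over_fibres[of "\<lambda>_. 1 :: int"] by simp
  then show ?thesis by (simp only: of_nat_eq_iff)
qed

text \<open>The arcs leaving w correspond to those leaving \<open>q w\<close>, and a head lies over
  z exactly if the image arc ends in z. The degree term is met in the fibre over z exactly if w lies
  there.\<close>

lemma neg_laplacian_quotient:
  assumes "w \<in> verts Y"
  shows "(neg_laplacian Z (q w) z :: 'a::comm_ring_1) =
    (\<Sum>w'\<in>{w' \<in> verts Y. q w' = z}. neg_laplacian Y w w')"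
proof -
  have pick: "(\<Sum>w'\<in>{w' \<in> verts Y. q w' = z}. of_bool (u = w')) = (of_bool (q u = z) :: 'a)"
    if "u \<in> verts Y" for u
  proof -
    have "(\<Sum>w'\<in>{w' \<in> verts Y. q w' = z}. of_bool (u = w')) =
        (\<Sum>w'\<in>{w' \<in> verts Y. q w' = z}. if u = w' then 1 else (0 :: 'a))"
      by (intro sum.cong) auto
    also have "\<dots> = of_bool (q u = z)"
      using that by (subst sum.delta') auto
    finally show ?thesis .
  qed
  have "(\<Sum>w'\<in>{w' \<in> verts Y. q w' = z}. neg_laplacian Y w w') =
      (\<Sum>e\<in>out_arcs Y w. \<Sum>w'\<in>{w' \<in> verts Y. q w' = z}. of_bool (head Y e = w') - of_bool (w = w') :: 'a)"
    unfolding neg_laplacian_def by (rule sum.swap)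
  also have "\<dots> = (\<Sum>e\<in>out_arcs Y w. of_bool (head Z (qa e) = z) - of_bool (q w = z))"
    using assms by (intro sum.cong) (simp_all add: sum_subtractf pick heads)
  also have "\<dots> = (\<Sum>f\<in>out_arcs Z (q w). of_bool (head Z f = z) - of_bool (q w = z))"
    by (rule sum.reindex_bij_betw[OF out_bij[OF assms]])
  finally show ?thesis by (simp add: neg_laplacian_def)
qed

text \<open>Induction step: the intermediate vertices of Z are replaced by their fibres, and these
  together run once through the vertices of Y.\<close>

lemma kernel_pow_quotient:
  assumes "w \<in> verts Y" "z \<in> verts Z"
  shows "(kernel_pow (verts Z) (neg_laplacian Z) k (q w) z :: 'a::comm_ring_1) =
    (\<Sum>w'\<in>{w' \<in> verts Y. q w' = z}. kernel_pow (verts Y) (neg_laplacian Y) k w w')"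
  using assms
proof (induction k arbitrary: z)
  case 0
  have "(\<Sum>w'\<in>{w' \<in> verts Y. q w' = z}. of_bool (w = w')) =
      (\<Sum>w'\<in>{w' \<in> verts Y. q w' = z}. if w = w' then 1 else (0 :: 'a))"
    by (intro sum.cong) auto
  also have "\<dots> = of_bool (q w = z)"
    using 0 by (subst sum.delta') auto
  finally show ?case by simp
next
  case (Suc k)
  let ?KY = "kernel_pow (verts Y) (neg_laplacian Y) k :: _ \<Rightarrow> _ \<Rightarrow> 'a"
  let ?LY = "neg_laplacian Y :: _ \<Rightarrow> _ \<Rightarrow> 'a" and ?LZ = "neg_laplacian Z :: _ \<Rightarrow> _ \<Rightarrow> 'a"
  have "kernel_pow (verts Z) ?LZ (Suc k) (q w) z =
      (\<Sum>u\<in>verts Z. \<Sum>w'\<in>{w' \<in> verts Y. q w' = u}. ?KY w w' * ?LZ (q w') z)"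
    using Suc by (simp add: sum_distrib_right)
  also have "\<dots> = (\<Sum>w'\<in>verts Y. ?KY w w' * ?LZ (q w') z)"
    by (rule sum.group) (auto simp: onto)
  also have "\<dots> = (\<Sum>w'\<in>verts Y. \<Sum>w''\<in>{w'' \<in> verts Y. q w'' = z}. ?KY w w' * ?LY w' w'')"
    by (intro sum.cong) (simp_all add: neg_laplacian_quotient sum_distrib_left)
  also have "\<dots> = (\<Sum>w''\<in>{w'' \<in> verts Y. q w'' = z}. \<Sum>w'\<in>verts Y. ?KY w w' * ?LY w' w'')"
    by (rule sum.swap)
  finally show ?case by simp
qed

text \<open>The diagonal of Z pulled back to Y counts each entry \<open>card H\<close> times. By
  freeness the fibre through w is run through once by \<open>act g w\<close> for g in H.\<close>

lemma trace_quotient: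
  "of_nat (card H) * (\<Sum>z\<in>verts Z. kernel_pow (verts Z) (neg_laplacian Z) k z z :: 'a::comm_ring_1) =
    (\<Sum>g\<in>H. \<Sum>w\<in>verts Y. kernel_pow (verts Y) (neg_laplacian Y) k w (act g w))"
proof -
  let ?KY = "kernel_pow (verts Y) (neg_laplacian Y) k :: _ \<Rightarrow> _ \<Rightarrow> 'a"
  let ?KZ = "kernel_pow (verts Z) (neg_laplacian Z) k :: _ \<Rightarrow> _ \<Rightarrow> 'a"
  have "of_nat (card H) * (\<Sum>z\<in>verts Z. ?KZ z z) = (\<Sum>w\<in>verts Y. ?KZ (q w) (q w))"
    by (rule sum_over_fibres[symmetric])
  also have "\<dots> = (\<Sum>w\<in>verts Y. \<Sum>w'\<in>{w' \<in> verts Y. q w' = q w}. ?KY w w')"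
    using onto by (intro sum.cong kernel_pow_quotient) auto
  also have "\<dots> = (\<Sum>w\<in>verts Y. \<Sum>g\<in>H. ?KY w (act g w))"
    by (intro sum.cong sum.reindex_bij_betw[symmetric] fibre) auto
  also have "\<dots> = (\<Sum>g\<in>H. \<Sum>w\<in>verts Y. ?KY w (act g w))"
    by (rule sum.swap)
  finally show ?thesis .
qed

end

section \<open>Deck groups and intermediate graphs\<close>

locale finite_cover = Y: bidirected_digraph Y j + Yf: fin_digraph Y +
    X: bidirected_digraph X i + Xf: fin_digraph X
  for Y :: "('v, 'e) pre_digraph" and j and X :: "('w, 'f) pre_digraph" and i +
  fixes \<pi> :: "('v, 'e, 'w, 'f) graph_map"
  assumes conn: "connected Y" and cov: "covering_map Y j X i \<pi>"
begin

lemma strongly_connected_Y: "strongly_connected Y"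
proof -
  have "symmetric Y"
    by (rule inversion_imp_symmetric[OF Y.bidirected_digraph]) auto
  then show ?thesis using conn by (rule Y.symmetric_connected_imp_strongly_connected)
qed

lemma cover_automorphismD:
  assumes "\<sigma> \<in> cover_automorphisms Y j \<pi>"
  shows "w \<in> verts Y \<Longrightarrow> fst \<sigma> w \<in> verts Y" "e \<in> arcs Y \<Longrightarrow> snd \<sigma> e \<in> arcs Y"
    "e \<in> arcs Y \<Longrightarrow> tail Y (snd \<sigma> e) = fst \<sigma> (tail Y e)"
    "e \<in> arcs Y \<Longrightarrow> head Y (snd \<sigma> e) = fst \<sigma> (head Y e)"
    "e \<in> arcs Y \<Longrightarrow> j (snd \<sigma> e) = snd \<sigma> (j e)"
    "w \<in> verts Y \<Longrightarrow> fst \<pi> (fst \<sigma> w) = fst \<pi> w" "e \<in> arcs Y \<Longrightarrow> snd \<pi> (snd \<sigma> e) = snd \<pi> e"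
    "w \<notin> verts Y \<Longrightarrow> fst \<sigma> w = w" "e \<notin> arcs Y \<Longrightarrow> snd \<sigma> e = e"
  using assms
  unfolding cover_automorphisms_def graph_isomorphism_def graph_morphism_def mem_Collect_eq
  by (meson image_subset_iff)+

text \<open>Uniqueness of lifts: as \<pi> is injective on the arcs leaving a vertex, agreement at
  one vertex propagates along arcs through the connected graph Y.\<close>

lemma cover_automorphisms_act_freely:
  assumes \<sigma>: "\<sigma> \<in> cover_automorphisms Y j \<pi>" and \<tau>: "\<tau> \<in> cover_automorphisms Y j \<pi>"
    and w: "w \<in> verts Y" "fst \<sigma> w = fst \<tau> w"
  shows "\<sigma> = \<tau>"
proof -
  have arcs_eq: "snd \<sigma> e = snd \<tau> e" if e: "e \<in> arcs Y" "fst \<sigma> (tail Y e) = fst \<tau> (tail Y e)" for e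
  proof -
    let ?v = "fst \<sigma> (tail Y e)"
    have "inj_on (snd \<pi>) (out_arcs Y ?v)"
      using cov e(1) cover_automorphismD(1)[OF \<sigma>] by (auto simp: covering_map_def bij_betw_def)
    moreover have "snd \<sigma> e \<in> out_arcs Y ?v" "snd \<tau> e \<in> out_arcs Y ?v"
      using e cover_automorphismD[OF \<sigma>] cover_automorphismD[OF \<tau>] by simp_all
    moreover have "snd \<pi> (snd \<sigma> e) = snd \<pi> (snd \<tau> e)"
      using e cover_automorphismD(7)[OF \<sigma>] cover_automorphismD(7)[OF \<tau>] by simp
    ultimately show ?thesis by (auto dest: inj_onD)
  qed
  have verts_eq: "fst \<sigma> v = fst \<tau> v" if v: "v \<in> verts Y" for v
  proof -
    have "w \<rightarrow>\<^sup>*\<^bsub>Y\<^esub> v" using strongly_connected_Y w v by (auto simp: strongly_connected_def)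
    then show ?thesis
    proof (induction rule: Y.reachable_induct)
      case (step x y)
      then obtain e where e: "e \<in> arcs Y" "tail Y e = x" "head Y e = y" by (auto elim: reachableE)
      then have "snd \<sigma> e = snd \<tau> e" using arcs_eq step by simp
      then show ?case
        using cover_automorphismD(4)[OF \<sigma> e(1)] cover_automorphismD(4)[OF \<tau> e(1)] e(3) by simp
    qed (use w in simp)
  qed
  \<comment> \<open>Outside Y both automorphisms are the identity by convention, so they agree as
    total functions.\<close>
  have "fst \<sigma> v = fst \<tau> v" for v
    using verts_eq cover_automorphismD(8)[OF \<sigma>] cover_automorphismD(8)[OF \<tau>]
    by (cases "v \<in> verts Y") auto
  moreover have "snd \<sigma> e = snd \<tau> e" for e
    using arcs_eq verts_eq cover_automorphismD(9)[OF \<sigma>] cover_automorphismD(9)[OF \<tau>]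
    by (cases "e \<in> arcs Y") auto
  ultimately show ?thesis by (simp add: prod_eq_iff fun_eq_iff)
qed

text \<open>Transitivity and freeness make every fibre of \<pi> a regular orbit, so X itself serves
  as the quotient by the full group, with \<pi> in place of the orbit map.\<close>

lemma free_quotient_galois:
  assumes "galois_cover Y j X i \<pi>"
  shows "free_quotient Y X (fst \<pi>) (snd \<pi>) (cover_automorphisms Y j \<pi>) fst"
proof unfold_locales
  show "fst \<pi> ` verts Y = verts X" using cov by (simp add: covering_map_def)
  show "bij_betw (snd \<pi>) (out_arcs Y w) (out_arcs X (fst \<pi> w))" if "w \<in> verts Y" for w
    using cov that by (simp add: covering_map_def)
  show "head X (snd \<pi> e) = fst \<pi> (head Y e)" if "e \<in> arcs Y" for e
    using cov that by (simp add: covering_map_def graph_morphism_def)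
  show "bij_betw (\<lambda>\<sigma>. fst \<sigma> w) (cover_automorphisms Y j \<pi>) {w' \<in> verts Y. fst \<pi> w' = fst \<pi> w}"
    if w: "w \<in> verts Y" for w
  proof (rule bij_betw_imageI)
    show "inj_on (\<lambda>\<sigma>. fst \<sigma> w) (cover_automorphisms Y j \<pi>)"
      using cover_automorphisms_act_freely[OF _ _ w] by (auto intro: inj_onI)
    show "(\<lambda>\<sigma>. fst \<sigma> w) ` cover_automorphisms Y j \<pi> = {w' \<in> verts Y. fst \<pi> w' = fst \<pi> w}"
    proof (intro equalityI subsetI)
      fix w' assume "w' \<in> (\<lambda>\<sigma>. fst \<sigma> w) ` cover_automorphisms Y j \<pi>"
      then show "w' \<in> {w' \<in> verts Y. fst \<pi> w' = fst \<pi> w}"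
        using w cover_automorphismD(1,6) by auto
    next
      fix w' assume "w' \<in> {w' \<in> verts Y. fst \<pi> w' = fst \<pi> w}"
      moreover have "fst \<pi> w \<in> verts X"
        using cov w by (auto simp: covering_map_def)
      ultimately obtain \<sigma> where "\<sigma> \<in> carrier (cover_group Y j \<pi>)" "fst \<sigma> w = w'"
        using assms w unfolding galois_cover_def by blast
      then show "w' \<in> (\<lambda>\<sigma>. fst \<sigma> w) ` cover_automorphisms Y j \<pi>"
        by (auto simp: cover_group_def)
    qed
  qed
qed

end

section \<open>Quotients by groups of deck transformations\<close>

text \<open>The group laws are phrased through the action alone, so that one statement covers the
  actions on vertices and on arcs.\<close>

lemma orbit_eq_iff:
  fixes act :: "'g \<Rightarrow> 'x \<Rightarrow> 'x"
  assumes one: "\<exists>g\<in>K. \<forall>x. act g x = x"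
    and mult: "\<And>g h. g \<in> K \<Longrightarrow> h \<in> K \<Longrightarrow> \<exists>k\<in>K. \<forall>x. act k x = act g (act h x)"
    and inv: "\<And>g. g \<in> K \<Longrightarrow> \<exists>h\<in>K. \<forall>x. act h (act g x) = x"
  shows "(\<lambda>g. act g y) ` K = (\<lambda>g. act g x) ` K \<longleftrightarrow> (\<exists>g\<in>K. y = act g x)"
proof
  assume eq: "(\<lambda>g. act g y) ` K = (\<lambda>g. act g x) ` K"
  have "y \<in> (\<lambda>g. act g y) ` K" using one by (metis image_eqI)
  then show "\<exists>g\<in>K. y = act g x" unfolding eq by blast
next
  have sub: "(\<lambda>h. act h (act g x)) ` K \<subseteq> (\<lambda>h. act h x) ` K" if g: "g \<in> K" for g x
  proof (rule image_subsetI)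
    fix h assume "h \<in> K"
    from mult[OF this g] obtain k where "k \<in> K" "\<forall>x. act k x = act h (act g x)" by blast
    then show "act h (act g x) \<in> (\<lambda>h. act h x) ` K" by (intro image_eqI[of _ _ k]) simp_all
  qed
  assume "\<exists>g\<in>K. y = act g x"
  then obtain g where g: "g \<in> K" "y = act g x" by blast
  obtain h where h: "h \<in> K" "act h y = x" using inv[OF g(1)] g(2) by metis
  show "(\<lambda>g. act g y) ` K = (\<lambda>g. act g x) ` K"
    using sub[OF g(1), of x] sub[OF h(1), of y] g(2) h(2) by simp
qed

locale deck_group = finite_cover +
  fixes K
  assumes sub: "K \<subseteq> cover_automorphisms Y j \<pi>" and id_in: "(id, id) \<in> K"
    and comp_in: "\<sigma> \<in> K \<Longrightarrow> \<tau> \<in> K \<Longrightarrow> (fst \<sigma> \<circ> fst \<tau>, snd \<sigma> \<circ> snd \<tau>) \<in> K"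
    and inv_in: "\<sigma> \<in> K \<Longrightarrow> \<exists>\<tau>\<in>K. fst \<tau> \<circ> fst \<sigma> = id \<and> snd \<tau> \<circ> snd \<sigma> = id"
begin

abbreviation "Z \<equiv> quotient_graph Y K"

lemmas K_D = cover_automorphismD[OF subsetD[OF sub]]

lemma vert_orbit_eq_iff: "vert_orbit K w' = vert_orbit K w \<longleftrightarrow> (\<exists>\<sigma>\<in>K. w' = fst \<sigma> w)"
  unfolding vert_orbit_def
proof (rule orbit_eq_iff)
  show "\<exists>g\<in>K. \<forall>x. fst g x = x" using id_in by (intro bexI[of _ "(id, id)"]) auto
  show "\<exists>k\<in>K. \<forall>x. fst k x = fst g (fst h x)" if "g \<in> K" "h \<in> K" for g h
    using comp_in[OF that] by (intro bexI[of _ "(fst g \<circ> fst h, snd g \<circ> snd h)"]) auto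
  show "\<exists>h\<in>K. \<forall>x. fst h (fst g x) = x" if "g \<in> K" for g
    using inv_in[OF that] by (metis comp_apply id_apply)
qed

lemma arc_orbit_eq_iff: "arc_orbit K e' = arc_orbit K e \<longleftrightarrow> (\<exists>\<sigma>\<in>K. e' = snd \<sigma> e)"
  unfolding arc_orbit_def
proof (rule orbit_eq_iff)
  show "\<exists>g\<in>K. \<forall>x. snd g x = x" using id_in by (intro bexI[of _ "(id, id)"]) auto
  show "\<exists>k\<in>K. \<forall>x. snd k x = snd g (snd h x)" if "g \<in> K" "h \<in> K" for g h
    using comp_in[OF that] by (intro bexI[of _ "(fst g \<circ> fst h, snd g \<circ> snd h)"]) auto
  show "\<exists>h\<in>K. \<forall>x. snd h (snd g x) = x" if "g \<in> K" for g
    using inv_in[OF that] by (metis comp_apply id_apply)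
qed

lemma quotient_simps:
  "verts Z = vert_orbit K ` verts Y" "arcs Z = arc_orbit K ` arcs Y"
  by (simp_all add: quotient_graph_def)

lemma tail_quotient: "e \<in> arcs Y \<Longrightarrow> tail Z (arc_orbit K e) = vert_orbit K (tail Y e)"
  by (simp add: quotient_graph_def arc_orbit_def vert_orbit_def image_image K_D(3) cong: image_cong)

lemma head_quotient: "e \<in> arcs Y \<Longrightarrow> head Z (arc_orbit K e) = vert_orbit K (head Y e)"
  by (simp add: quotient_graph_def arc_orbit_def vert_orbit_def image_image K_D(4) cong: image_cong)

lemma inversion_quotient: "e \<in> arcs Y \<Longrightarrow> quotient_inversion Y j K (arc_orbit K e) = arc_orbit K (j e)"
proof -
  assume e: "e \<in> arcs Y"
  then have "arc_orbit K e \<in> arcs Z" by (simp add: quotient_simps)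
  moreover have "j ` arc_orbit K e = arc_orbit K (j e)"
    using e by (simp add: arc_orbit_def image_image K_D(5) cong: image_cong)
  ultimately show ?thesis by (simp add: quotient_inversion_def)
qed

lemma fin_digraph_quotient: "fin_digraph Z"
proof
  fix E assume "E \<in> arcs Z"
  then obtain e where "e \<in> arcs Y" "E = arc_orbit K e" by (auto simp: quotient_simps)
  then show "tail Z E \<in> verts Z" "head Z E \<in> verts Z"
    by (simp_all add: tail_quotient head_quotient) (simp_all add: quotient_simps)
qed (simp_all add: quotient_simps)

lemma bidirected_digraph_quotient: "bidirected_digraph Z (quotient_inversion Y j K)"
proof -
  interpret Z: fin_digraph Z by (rule fin_digraph_quotient)
  show ?thesis
  proof (rule Z.bidirected_digraphI)
    fix E assume "E \<notin> arcs Z"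
    then show "quotient_inversion Y j K E = E" by (simp add: quotient_inversion_def)
  next
    fix E assume "E \<in> arcs Z"
    then obtain e where e: "e \<in> arcs Y" "E = arc_orbit K e" by (auto simp: quotient_simps)
    \<comment> \<open>An automorphism sending e to its inverse would, after projection by \<pi>,
      make an arc of X its own inverse.\<close>
    show "quotient_inversion Y j K E \<noteq> E"
    proof
      assume "quotient_inversion Y j K E = E"
      then have "arc_orbit K (j e) = arc_orbit K e" using e by (simp add: inversion_quotient)
      then obtain \<sigma> where \<sigma>: "\<sigma> \<in> K" "j e = snd \<sigma> e" by (auto simp: arc_orbit_eq_iff)
      have "i (snd \<pi> e) = snd \<pi> (j e)" "snd \<pi> e \<in> arcs X"
        using cov e(1) by (auto simp: covering_map_def graph_morphism_def)
      then have "i (snd \<pi> e) = snd \<pi> e" using K_D(7)[OF \<sigma>(1) e(1)] \<sigma>(2) by simp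
      then show False using X.arev_neq[OF \<open>snd \<pi> e \<in> arcs X\<close>] by simp
    qed
    show "quotient_inversion Y j K (quotient_inversion Y j K E) = E"
      using e by (simp add: inversion_quotient)
    show "tail Z (quotient_inversion Y j K E) = head Z E"
      using e by (simp add: inversion_quotient tail_quotient head_quotient)
  qed
qed

lemma connected_quotient: "connected Z"
proof (rule strongly_connected_imp_connected, rule strongly_connectedI)
  interpret Z: fin_digraph Z by (rule fin_digraph_quotient)
  show "verts Z \<noteq> {}"
    using strongly_connected_Y by (auto simp: strongly_connected_def quotient_simps)
  fix u' v' assume "u' \<in> verts Z" "v' \<in> verts Z"
  then obtain u v where uv: "u \<in> verts Y" "u' = vert_orbit K u" "v \<in> verts Y" "v' = vert_orbit K v"
    by (auto simp: quotient_simps)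
  then have "u \<rightarrow>\<^sup>*\<^bsub>Y\<^esub> v" using strongly_connected_Y by (auto simp: strongly_connected_def)
  then have "vert_orbit K u \<rightarrow>\<^sup>*\<^bsub>Z\<^esub> vert_orbit K v"
  proof (induction rule: Y.reachable_induct)
    case base
    then show ?case by (intro Z.reachable_refl) (simp add: quotient_simps)
  next
    case (step x y)
    then obtain e where e: "e \<in> arcs Y" "tail Y e = x" "head Y e = y" by (auto elim: reachableE)
    then have "vert_orbit K x \<rightarrow>\<^bsub>Z\<^esub> vert_orbit K y"
      by (intro Z.dominatesI[of "arc_orbit K e"])
         (simp_all add: arc_to_ends_def tail_quotient head_quotient quotient_simps)
    with step show ?case by (rule_tac Z.reachable_adj_trans)
  qed
  then show "u' \<rightarrow>\<^sup>*\<^bsub>Z\<^esub> v'" using uv by simp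
qed

lemma free_quotient_orbits: "free_quotient Y Z (vert_orbit K) (arc_orbit K) K fst"
proof (intro free_quotient.intro free_quotient_axioms.intro fin_digraph_quotient Yf.fin_digraph_axioms)
  show "vert_orbit K ` verts Y = verts Z" by (simp add: quotient_simps)
  show "head Z (arc_orbit K e) = vert_orbit K (head Y e)" if "e \<in> arcs Y" for e
    by (rule head_quotient[OF that])
  show "bij_betw (arc_orbit K) (out_arcs Y w) (out_arcs Z (vert_orbit K w))" if w: "w \<in> verts Y" for w
  proof (rule bij_betw_imageI)
    \<comment> \<open>An automorphism relating two arcs that leave w fixes w, so it is the identity
      by freeness.\<close>
    show "inj_on (arc_orbit K) (out_arcs Y w)"
    proof (rule inj_onI)
      fix e f assume ef: "e \<in> out_arcs Y w" "f \<in> out_arcs Y w" "arc_orbit K e = arc_orbit K f"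
      then obtain \<sigma> where \<sigma>: "\<sigma> \<in> K" "e = snd \<sigma> f" by (auto simp: arc_orbit_eq_iff)
      then have "fst \<sigma> w = fst (id, id) w" using ef K_D(3)[OF \<sigma>(1), of f] by simp
      then have "\<sigma> = (id, id)"
        using cover_automorphisms_act_freely[of \<sigma> "(id, id)"] w \<sigma>(1) id_in sub by blast
      then show "e = f" using \<sigma>(2) by simp
    qed
    show "arc_orbit K ` out_arcs Y w = out_arcs Z (vert_orbit K w)"
    proof (intro equalityI subsetI)
      fix E assume "E \<in> arc_orbit K ` out_arcs Y w"
      then obtain e where "e \<in> arcs Y" "tail Y e = w" "E = arc_orbit K e" by auto
      then show "E \<in> out_arcs Z (vert_orbit K w)"
        using tail_quotient[of e] by (simp add: quotient_simps)
    next
      fix E assume "E \<in> out_arcs Z (vert_orbit K w)"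
      then have E: "E \<in> arcs Z" "tail Z E = vert_orbit K w" by auto
      then obtain e where e: "e \<in> arcs Y" "E = arc_orbit K e" by (auto simp: quotient_simps)
      then have "vert_orbit K w = vert_orbit K (tail Y e)" using E tail_quotient by simp
      \<comment> \<open>Translating the representative e by \<sigma> gives an arc of the same orbit
        that leaves w.\<close>
      then obtain \<sigma> where \<sigma>: "\<sigma> \<in> K" "w = fst \<sigma> (tail Y e)" by (auto simp: vert_orbit_eq_iff)
      have "snd \<sigma> e \<in> out_arcs Y w" using \<sigma> e K_D(2,3)[OF \<sigma>(1)] by simp
      moreover have "arc_orbit K (snd \<sigma> e) = E"
        using arc_orbit_eq_iff[of "snd \<sigma> e" e] \<sigma>(1) e(2) by blast
      ultimately show "E \<in> arc_orbit K ` out_arcs Y w" by blast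
    qed
  qed
  show "bij_betw (\<lambda>\<sigma>. fst \<sigma> w) K {w' \<in> verts Y. vert_orbit K w' = vert_orbit K w}"
    if w: "w \<in> verts Y" for w
  proof (rule bij_betw_imageI)
    show "inj_on (\<lambda>\<sigma>. fst \<sigma> w) K"
      using cover_automorphisms_act_freely[OF _ _ w] sub by (blast intro: inj_onI)
    show "(\<lambda>\<sigma>. fst \<sigma> w) ` K = {w' \<in> verts Y. vert_orbit K w' = vert_orbit K w}"
      unfolding vert_orbit_eq_iff using w K_D(1) by blast
  qed
qed

end

section \<open>The product formula\<close>

lemma ln_forest_poly_tendsto:
  assumes "bidirected_digraph X i" "fin_digraph X" "connected X"
  shows "((\<lambda>x. ln (forest_poly X x / x)) \<longlongrightarrow> ln (real (card (verts X) * complexity X i)))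
    (at_right 0)"
proof (rule tendsto_ln[OF forest_poly_asymptotics[OF assms]])
  have "verts X \<noteq> {}" using assms(3) by (auto simp: connected_conv)
  then show "real (card (verts X) * complexity X i) \<noteq> 0"
    using complexity_pos[OF assms] fin_digraph.finite_verts[OF assms(2)] by simp
qed

lemma ln_complexity_relation:
  fixes Z :: "'c \<Rightarrow> ('v, 'e) pre_digraph" and X :: "('w, 'f) pre_digraph" and a :: "'c \<Rightarrow> real"
  assumes fin: "finite I"
    and X: "bidirected_digraph X i" "fin_digraph X" "connected X"
    and Z: "\<And>C. C \<in> I \<Longrightarrow> bidirected_digraph (Z C) (\<iota> C)" "\<And>C. C \<in> I \<Longrightarrow> fin_digraph (Z C)"
      "\<And>C. C \<in> I \<Longrightarrow> connected (Z C)"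
    and tr: "\<And>k. (\<Sum>v\<in>verts X. kernel_pow (verts X) (neg_laplacian X) k v v) =
      (\<Sum>C\<in>I. complex_of_real (a C) *
        (\<Sum>v\<in>verts (Z C). kernel_pow (verts (Z C)) (neg_laplacian (Z C)) k v v))"
    and a: "sum a I = 1"
  shows "ln (real (card (verts X) * complexity X i)) =
    (\<Sum>C\<in>I. a C * ln (real (card (verts (Z C)) * complexity (Z C) (\<iota> C))))"
proof -
  obtain b where b: "bij_betw b {0..<card (verts X)} (verts X)"
    using ex_bij_betw_nat_finite fin_digraph.finite_verts[OF X(2)] by metis
  have "\<forall>C\<in>I. \<exists>b. bij_betw b {0..<card (verts (Z C))} (verts (Z C))"
    using ex_bij_betw_nat_finite fin_digraph.finite_verts[OF Z(2)] by metis
  then obtain d where d: "\<And>C. C \<in> I \<Longrightarrow> bij_betw (d C) {0..<card (verts (Z C))} (verts (Z C))"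
    by metis
  let ?N = "vertex_mat (card (verts X)) b (neg_laplacian X) :: complex mat"
  let ?M = "\<lambda>C. vertex_mat (card (verts (Z C))) (d C) (neg_laplacian (Z C)) :: complex mat"
  have trace: "mat_trace (?N ^\<^sub>m k) = (\<Sum>C\<in>I. of_real (a C) * mat_trace (?M C ^\<^sub>m k))" for k
    unfolding mat_trace_vertex_mat_pow[OF b] tr
    by (intro sum.cong) (simp_all add: mat_trace_vertex_mat_pow[OF d])
  have rel: "ln (forest_poly X x / x) = (\<Sum>C\<in>I. a C * ln (forest_poly (Z C) x / x))"
    if x: "x > 0" for x
  proof -
    note posX = forest_poly_pos[OF X x]
    have posZ: "forest_poly (Z C) x > 0" if "C \<in> I" for C
      by (rule forest_poly_pos[OF Z[OF that] x])
    have detZ: "det (of_real x \<cdot>\<^sub>m 1\<^sub>m (card (verts (Z C))) - ?M C) =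
        complex_of_real (forest_poly (Z C) x)" if "C \<in> I" for C
      by (rule det_eq_forest_poly[OF Z(2)[OF that] d[OF that]])
    have "ln (forest_poly X x) =
        ln (cmod (det (of_real x \<cdot>\<^sub>m 1\<^sub>m (card (verts X)) - ?N)))"
      using posX by (simp add: det_eq_forest_poly[OF X(2) b])
    also have "\<dots> = (\<Sum>C\<in>I. a C * ln (cmod (det (of_real x \<cdot>\<^sub>m 1\<^sub>m (card (verts (Z C))) - ?M C))))"
    proof (rule ln_det_relation[OF fin _ _ trace])
      show "det (of_real x \<cdot>\<^sub>m 1\<^sub>m (card (verts X)) - ?N) \<noteq> 0"
        using posX by (simp add: det_eq_forest_poly[OF X(2) b])
      show "det (of_real x \<cdot>\<^sub>m 1\<^sub>m (card (verts (Z C))) - ?M C) \<noteq> 0" if "C \<in> I" for C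
        using posZ[OF that] by (simp add: detZ[OF that])
    qed simp_all
    also have "\<dots> = (\<Sum>C\<in>I. a C * ln (forest_poly (Z C) x))"
    proof (rule sum.cong)
      fix C assume C: "C \<in> I"
      show "a C * ln (cmod (det (of_real x \<cdot>\<^sub>m 1\<^sub>m (card (verts (Z C))) - ?M C))) =
          a C * ln (forest_poly (Z C) x)"
        using posZ[OF C] by (simp add: detZ[OF C])
    qed simp
    finally have eq: "ln (forest_poly X x) = (\<Sum>C\<in>I. a C * ln (forest_poly (Z C) x))" .
    \<comment> \<open>Dividing by x lowers both sides by \<open>ln x\<close>, since the coefficients
      sum to 1; only after this division do the limits at 0 exist.\<close>
    have "ln (forest_poly (Z C) x / x) = ln (forest_poly (Z C) x) - ln x" if "C \<in> I" for C
      using posZ[OF that] x by (simp add: ln_div)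
    then have "(\<Sum>C\<in>I. a C * ln (forest_poly (Z C) x / x)) =
        (\<Sum>C\<in>I. a C * ln (forest_poly (Z C) x) - a C * ln x)"
      by (intro sum.cong) (simp_all add: right_diff_distrib)
    also have "\<dots> = ln (forest_poly X x) - ln x"
      by (simp add: sum_subtractf eq a flip: sum_distrib_right)
    finally show ?thesis using posX x by (simp add: ln_div)
  qed
  have "((\<lambda>x. ln (forest_poly X x / x)) \<longlongrightarrow>
      (\<Sum>C\<in>I. a C * ln (real (card (verts (Z C)) * complexity (Z C) (\<iota> C))))) (at_right 0)"
  proof (rule Lim_transform_eventually)
    show "((\<lambda>x. \<Sum>C\<in>I. a C * ln (forest_poly (Z C) x / x)) \<longlongrightarrow>
        (\<Sum>C\<in>I. a C * ln (real (card (verts (Z C)) * complexity (Z C) (\<iota> C))))) (at_right 0)"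
      by (intro tendsto_sum tendsto_mult tendsto_const ln_forest_poly_tendsto Z)
    show "\<forall>\<^sub>F x in at_right 0. (\<Sum>C\<in>I. a C * ln (forest_poly (Z C) x / x)) =
        ln (forest_poly X x / x)"
      by (auto simp: rel eventually_at_filter)
  qed
  with ln_forest_poly_tendsto[OF X] show ?thesis
    by (rule tendsto_unique[OF trivial_limit_at_right_real])
qed

section \<open>Subgroups of G as deck groups, and the conclusion\<close>

lemma (in finite_cover) deck_group_image:
  fixes G (structure)
  assumes G: "group G" and \<phi>: "\<phi> \<in> iso G (cover_group Y j \<pi>)" and C: "subgroup C G"
  shows "deck_group Y j X i \<pi> (\<phi> ` C)"
proof -
  interpret group G by fact
  interpret C: subgroup C G by fact
  have mult: "\<phi> (g \<otimes> h) = (fst (\<phi> g) \<circ> fst (\<phi> h), snd (\<phi> g) \<circ> snd (\<phi> h))"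
    if "g \<in> carrier G" "h \<in> carrier G" for g h
    using \<phi> that by (simp add: iso_def hom_def cover_group_def)
  have bij: "bij_betw \<phi> (carrier G) (cover_automorphisms Y j \<pi>)"
    using \<phi> by (simp add: iso_def cover_group_def)
  have "(id, id) \<in> cover_automorphisms Y j \<pi>"
    by (auto simp: cover_automorphisms_def graph_isomorphism_def graph_morphism_def)
  then obtain g where g: "g \<in> carrier G" "\<phi> g = (id, id)"
    using bij by (metis bij_betw_imp_surj_on imageE)
  \<comment> \<open>The preimage g of the identity pair is idempotent, hence the unit of G.\<close>
  then have "\<phi> (g \<otimes> g) = \<phi> g" by (simp add: mult)
  then have "g \<otimes> g = g" using bij g(1) by (auto simp: bij_betw_def dest: inj_onD)
  then have one: "\<phi> \<one> = (id, id)" using g by simp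
  show ?thesis
  proof unfold_locales
    show "\<phi> ` C \<subseteq> cover_automorphisms Y j \<pi>"
      using bij C.subset by (auto simp: bij_betw_def)
    show "(id, id) \<in> \<phi> ` C" using one C.one_closed by (metis image_eqI)
    show "(fst \<sigma> \<circ> fst \<tau>, snd \<sigma> \<circ> snd \<tau>) \<in> \<phi> ` C" if \<sigma>\<tau>: "\<sigma> \<in> \<phi> ` C" "\<tau> \<in> \<phi> ` C" for \<sigma> \<tau>
    proof -
      obtain g h where gh: "g \<in> C" "h \<in> C" "\<sigma> = \<phi> g" "\<tau> = \<phi> h" using \<sigma>\<tau> by blast
      then have "(fst \<sigma> \<circ> fst \<tau>, snd \<sigma> \<circ> snd \<tau>) = \<phi> (g \<otimes> h)" by (simp add: mult)
      then show ?thesis using gh by simp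
    qed
    show "\<exists>\<tau>\<in>\<phi> ` C. fst \<tau> \<circ> fst \<sigma> = id \<and> snd \<tau> \<circ> snd \<sigma> = id" if \<sigma>: "\<sigma> \<in> \<phi> ` C" for \<sigma>
    proof -
      obtain g where g: "g \<in> C" "\<sigma> = \<phi> g" using \<sigma> by blast
      then have "(fst (\<phi> (inv g)) \<circ> fst \<sigma>, snd (\<phi> (inv g)) \<circ> snd \<sigma>) = (id, id)"
        using mult[of "inv g" g] one by simp
      then show ?thesis using g by (intro bexI[of _ "\<phi> (inv g)"]) simp_all
    qed
  qed
qed

theorem theorem1p2:
  fixes G :: "('g, 'm) monoid_scheme"
    and Y :: "('v, 'e) pre_digraph" and j :: "'e \<Rightarrow> 'e"
    and X :: "('w, 'f) pre_digraph" and i :: "'f \<Rightarrow> 'f"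
    and \<pi> :: "('v, 'e, 'w, 'f) graph_map"
    and \<phi> :: "'g \<Rightarrow> ('v, 'e, 'v, 'e) graph_map"
  assumes "group G" and "finite (carrier G)"
    and "bidirected_digraph X i" and "fin_digraph X" and "connected X"
    and "bidirected_digraph Y j" and "fin_digraph Y" and "connected Y"
    and "galois_cover Y j X i \<pi>"
    and "\<phi> \<in> iso G (cover_group Y j \<pi>)"
  shows "real (complexity X i) =
    (\<Prod>C\<in>cyclic_subgroups G.
      (real (card (rcosets\<^bsub>G\<^esub> C)) *
        real (complexity (quotient_graph Y (\<phi> ` C)) (quotient_inversion Y j (\<phi> ` C))))
      powr (- (1 / real (card (rcosets\<^bsub>G\<^esub> C))) *
            real_of_int (moebius (cyclic_subgroups_top G) (Fin C) Pinf)))"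
proof -
  interpret G: group G by fact
  interpret finite_cover Y j X i \<pi>
    using assms by (simp add: finite_cover_def finite_cover_axioms_def galois_cover_def)
  let ?I = "cyclic_subgroups G"
  define \<mu> where "\<mu> C = moebius (cyclic_subgroups_top G) (Fin C) Pinf" for C
  define Z where "Z C = quotient_graph Y (\<phi> ` C)" for C
  define \<iota> where "\<iota> C = quotient_inversion Y j (\<phi> ` C)" for C
  define a where "a C = - (1 / real (card (rcosets\<^bsub>G\<^esub> C))) * real_of_int (\<mu> C)" for C
  have finI: "finite ?I" by (rule G.finite_cyclic_subgroups[OF assms(2)])
  have inj: "inj_on \<phi> (carrier G)" and img: "\<phi> ` carrier G = cover_automorphisms Y j \<pi>"
    using assms(10) by (auto simp: iso_def cover_group_def bij_betw_def)
  have sub: "subgroup C G" "C \<subseteq> carrier G" if "C \<in> ?I" for C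
    using that by (auto simp: cyclic_subgroups_def dest: subgroup.mem_carrier)
  have dg: "deck_group Y j X i \<pi> (\<phi> ` C)" if "C \<in> ?I" for C
    by (rule deck_group_image[OF assms(1,10) sub(1)[OF that]])
  have card_img: "card (\<phi> ` C) = card C" if "C \<subseteq> carrier G" for C
    using inj_on_subset[OF inj that] by (rule card_image)
  have lagrange: "card (carrier G) = card (rcosets\<^bsub>G\<^esub> C) * card C" if "C \<in> ?I" for C
    using G.lagrange[OF sub(1)[OF that]] by (simp add: Coset.order_def)
  have cardG: "card (carrier G) > 0" using assms(2) by (auto simp: card_gt_0_iff)
  have index: "card (rcosets\<^bsub>G\<^esub> C) > 0" "card C > 0" if "C \<in> ?I" for C
    using lagrange[OF that] cardG by simp_all
  \<comment> \<open>As |G| = [G : C] |C|, the exponent times |G| is the Moebius coefficient times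
    |C|, and this |C| is the factor in \<open>trace_quotient\<close>.\<close>
  have a_eq: "a C * real (card (carrier G)) = - real_of_int (\<mu> C) * real (card C)" if "C \<in> ?I" for C
    using index[OF that] by (simp add: a_def lagrange[OF that])
  interpret X: free_quotient Y X "fst \<pi>" "snd \<pi>" "cover_automorphisms Y j \<pi>" fst
    by (rule free_quotient_galois[OF assms(9)])
  have fq: "free_quotient Y (Z C) (vert_orbit (\<phi> ` C)) (arc_orbit (\<phi> ` C)) (\<phi> ` C) fst"
    if "C \<in> ?I" for C
    unfolding Z_def by (rule deck_group.free_quotient_orbits[OF dg[OF that]])
  have Z: "bidirected_digraph (Z C) (\<iota> C)" "fin_digraph (Z C)" "connected (Z C)" if "C \<in> ?I" for C
    unfolding Z_def \<iota>_def
    using deck_group.bidirected_digraph_quotient[OF dg[OF that]]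
      deck_group.fin_digraph_quotient[OF dg[OF that]]
      deck_group.connected_quotient[OF dg[OF that]] by simp_all
  \<comment> \<open>Both C and G act freely on the vertices of Y, so |Y| = |C| |X_C| = |G|
    |X|.\<close>
  have card_Z: "card (verts (Z C)) = card (rcosets\<^bsub>G\<^esub> C) * card (verts X)" if "C \<in> ?I" for C
  proof -
    have "card C * card (verts (Z C)) = card (carrier G) * card (verts X)"
      using free_quotient.card_verts[OF fq[OF that]] X.card_verts card_img[OF sub(2)[OF that]]
        card_img[of "carrier G"] img by simp
    then show ?thesis using index[OF that] by (simp add: lagrange[OF that])
  qed
  \<comment> \<open>The inversion formula over cyclic subgroups, applied to the constant function
    1.\<close>
  have sum_a: "sum a ?I = 1"
  proof -
    have "sum a ?I * real (card (carrier G)) = (\<Sum>C\<in>?I. - real_of_int (\<mu> C) * (\<Sum>g\<in>C. 1))"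
      unfolding sum_distrib_right by (intro sum.cong) (simp_all add: a_eq)
    also have "\<dots> = (\<Sum>g\<in>carrier G. 1)"
      unfolding \<mu>_def by (rule G.sum_via_cyclic_subgroups[OF assms(2)])
    finally show ?thesis using cardG by simp
  qed
  have traces: "(\<Sum>v\<in>verts X. kernel_pow (verts X) (neg_laplacian X) k v v) =
      (\<Sum>C\<in>?I. complex_of_real (a C) *
        (\<Sum>v\<in>verts (Z C). kernel_pow (verts (Z C)) (neg_laplacian (Z C)) k v v))" for k
  proof -
    \<comment> \<open>The function on G to be inverted: its average over C is the power trace on
      X_C, its average over G the one on X.\<close>
    define t where "t g = (\<Sum>w\<in>verts Y. kernel_pow (verts Y) (neg_laplacian Y) k w (fst (\<phi> g) w) :: complex)" for g
    define trX where "trX = (\<Sum>v\<in>verts X. kernel_pow (verts X) (neg_laplacian X) k v v :: complex)"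
    define trZ where "trZ C = (\<Sum>v\<in>verts (Z C). kernel_pow (verts (Z C)) (neg_laplacian (Z C)) k v v :: complex)" for C
    have sum_t: "(\<Sum>\<sigma>\<in>\<phi> ` C. \<Sum>w\<in>verts Y. kernel_pow (verts Y) (neg_laplacian Y) k w (fst \<sigma> w)) = sum t C"
      if "C \<subseteq> carrier G" for C
      using inj_on_subset[OF inj that] by (simp add: sum.reindex t_def)
    have tX: "of_nat (card (carrier G)) * trX = sum t (carrier G)"
      using X.trace_quotient[of k, where 'a = complex] card_img[of "carrier G"] sum_t[of "carrier G"]
      by (simp add: trX_def img)
    have tZ: "of_nat (card C) * trZ C = sum t C" if "C \<in> ?I" for C
      using free_quotient.trace_quotient[OF fq[OF that], of k, where 'a = complex]
        card_img[OF sub(2)[OF that]] sum_t[OF sub(2)[OF that]] by (simp add: trZ_def)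
    have "of_nat (card (carrier G)) * trX = (\<Sum>C\<in>?I. - of_int (\<mu> C) * sum t C)"
      unfolding tX \<mu>_def by (rule G.sum_via_cyclic_subgroups[OF assms(2), symmetric])
    also have "\<dots> = (\<Sum>C\<in>?I. of_nat (card (carrier G)) * (of_real (a C) * trZ C))"
    proof (rule sum.cong)
      fix C assume C: "C \<in> ?I"
      have "of_nat (card (carrier G)) * complex_of_real (a C) = - of_int (\<mu> C) * of_nat (card C)"
        using arg_cong[OF a_eq[OF C], of complex_of_real] by (simp add: mult.commute)
      then show "- of_int (\<mu> C) * sum t C = of_nat (card (carrier G)) * (of_real (a C) * trZ C)"
        by (simp add: tZ[OF C, symmetric] flip: mult.assoc)
    qed simp
    finally have "trX = (\<Sum>C\<in>?I. of_real (a C) * trZ C)"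
      using cardG by (simp flip: sum_distrib_left)
    then show ?thesis by (simp add: trX_def trZ_def)
  qed
  have n: "card (verts X) > 0"
    using assms(4,5) fin_digraph.finite_verts by (fastforce simp: connected_conv card_gt_0_iff)
  have \<kappa>: "complexity X i > 0" by (rule complexity_pos[OF assms(3-5)])
  have \<kappa>Z: "real (card (rcosets\<^bsub>G\<^esub> C)) * real (complexity (Z C) (\<iota> C)) > 0" if "C \<in> ?I" for C
    using complexity_pos[OF Z[OF that]] index[OF that] by simp
  have "ln (real (card (verts X))) + ln (real (complexity X i)) =
      ln (real (card (verts X) * complexity X i))"
    unfolding of_nat_mult using n \<kappa> by (intro ln_mult_pos[symmetric]) (simp_all only: of_nat_0_less_iff)
  also have "\<dots> = (\<Sum>C\<in>?I. a C * ln (real (card (verts (Z C)) * complexity (Z C) (\<iota> C))))"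
    by (rule ln_complexity_relation[OF finI assms(3-5) Z traces sum_a])
  \<comment> \<open>The vertex count of X_C splits off |X|, whose logarithm has total weight 1 and
    cancels against the left side; the index [G : C] remains in the formula.\<close>
  also have "\<dots> = (\<Sum>C\<in>?I. a C * ln (real (card (verts X))) +
      a C * ln (real (card (rcosets\<^bsub>G\<^esub> C)) * real (complexity (Z C) (\<iota> C))))"
  proof (rule sum.cong)
    fix C assume C: "C \<in> ?I"
    have "real (card (verts (Z C)) * complexity (Z C) (\<iota> C)) =
        real (card (verts X)) * (real (card (rcosets\<^bsub>G\<^esub> C)) * real (complexity (Z C) (\<iota> C)))"
      by (simp add: card_Z[OF C])
    then show "a C * ln (real (card (verts (Z C)) * complexity (Z C) (\<iota> C))) =
        a C * ln (real (card (verts X))) +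
        a C * ln (real (card (rcosets\<^bsub>G\<^esub> C)) * real (complexity (Z C) (\<iota> C)))"
      using n \<kappa>Z[OF C] by (simp only: ln_mult_pos of_nat_0_less_iff distrib_left)
  qed simp
  also have "\<dots> = ln (real (card (verts X))) +
      (\<Sum>C\<in>?I. a C * ln (real (card (rcosets\<^bsub>G\<^esub> C)) * real (complexity (Z C) (\<iota> C))))"
    by (simp only: sum.distrib sum_a mult_1 flip: sum_distrib_right)
  finally have "ln (real (complexity X i)) =
      (\<Sum>C\<in>?I. a C * ln (real (card (rcosets\<^bsub>G\<^esub> C)) * real (complexity (Z C) (\<iota> C))))"
    by simp
  then have "real (complexity X i) =
      exp (\<Sum>C\<in>?I. a C * ln (real (card (rcosets\<^bsub>G\<^esub> C)) * real (complexity (Z C) (\<iota> C))))"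
    using \<kappa> by (metis exp_ln of_nat_0_less_iff)
  also have "\<dots> = (\<Prod>C\<in>?I. (real (card (rcosets\<^bsub>G\<^esub> C)) * real (complexity (Z C) (\<iota> C))) powr a C)"
    unfolding exp_sum[OF finI]
  proof (rule prod.cong)
    fix C assume C: "C \<in> ?I"
    \<comment> \<open>\<open>powr\<close> is \<open>exp\<close> of a multiple of \<open>ln\<close>
      only for a nonzero base; at base 0 it has the default value 0.\<close>
    note \<kappa>Z[OF C, THEN less_imp_neq, THEN not_sym]
    then show "exp (a C * ln (real (card (rcosets\<^bsub>G\<^esub> C)) * real (complexity (Z C) (\<iota> C)))) =
        (real (card (rcosets\<^bsub>G\<^esub> C)) * real (complexity (Z C) (\<iota> C))) powr a C"
      by (simp only: powr_def if_False)
  qed simp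
  finally show ?thesis by (simp only: a_def \<mu>_def Z_def \<iota>_def)
qed

end
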